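(* There is an algorithm that, for a given tree $T$ of order $n$ and a given function $w:V(T)\to \mathbb{Z}_{\geq 0}$, determines a connected $w$-safe set $S$ in $T$ with $w(S)\leq 2\,cs(T,w)$ in time $O(n^2)$.
   Context: For a graph $G$, a weight function $w:V(G)\to\mathbb{Z}_{\geq 0}$, a set $U\subseteq V(G)$ and a subgraph $H$ of $G$, let $w(U)=\sum_{u\in U}w(u)$ and $w(H)=w(V(H))$. Two disjoint subgraphs $C,D$ of $G$ are adjacent if some vertex of $C$ is adjacent to some vertex of $D$. A set $S\subseteq V(G)$ is $w$-safe if $w(C)\geq w(D)$ for every component $C$ of the induced subgraph $G[S]$ and every component $D$ of $G-S$ such that $D$ is adjacent to $C$. A set $S$ is connected if $G[S]$ is connected. The connected safe number $cs(G,w)$ is the minimum of $w(S)$ over all connected $w$-safe sets $S$ in $G$. *)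

theory Defs
  imports "Graph_Theory.Graph_Theory" "HOL-Library.Landau_Symbols"
begin

section \<open>Weighted safe sets\<close>

text \<open>
  A finite simple undirected graph is a \<open>pair_graph\<close>: a finite, loopfree, symmetric digraph
  without parallel arcs, each edge $uv$ being the two arcs $(u,v)$ and $(v,u)$. For such graphs
  the strongly connected components (\<open>sccs\<close>) are the connected components. The null graph
  is not \<open>connected\<close>, so connected sets are non-empty.
\<close>

definition adjacent_subgraphs ::
    "('a,'b) pre_digraph \<Rightarrow> ('a,'b) pre_digraph \<Rightarrow> ('a,'b) pre_digraph \<Rightarrow> bool" where
  "adjacent_subgraphs G C D \<longleftrightarrow> (\<exists>u\<in>verts C. \<exists>v\<in>verts D. u \<rightarrow>\<^bsub>G\<^esub> v)"

definition safe_set :: "('a,'b) pre_digraph \<Rightarrow> ('a \<Rightarrow> nat) \<Rightarrow> 'a set \<Rightarrow> bool" where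
  "safe_set G w S \<longleftrightarrow> S \<subseteq> verts G \<and>
     (\<forall>C\<in>pre_digraph.sccs (G \<restriction> S). \<forall>D\<in>pre_digraph.sccs (G \<restriction> (verts G - S)).
        adjacent_subgraphs G C D \<longrightarrow> sum w (verts C) \<ge> sum w (verts D))"

text \<open>The name \<open>connected\<close> is qualified because topological connectedness has the same name.\<close>

definition connected_set :: "('a,'b) pre_digraph \<Rightarrow> 'a set \<Rightarrow> bool" where
  "connected_set G S \<longleftrightarrow> Digraph_Component.connected (G \<restriction> S)"

definition connected_safe_set :: "('a,'b) pre_digraph \<Rightarrow> ('a \<Rightarrow> nat) \<Rightarrow> 'a set \<Rightarrow> bool" where
  "connected_safe_set G w S \<longleftrightarrow> safe_set G w S \<and> connected_set G S"

definition cs :: "('a,'b) pre_digraph \<Rightarrow> ('a \<Rightarrow> nat) \<Rightarrow> nat" where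
  "cs G w = Min {sum w S | S. connected_safe_set G w S}"

text \<open>
  The library predicate \<open>tree\<close> excludes all directed cycles, hence every edge of a symmetric
  digraph. The cycles of an undirected simple graph are the cycles of length at least 3 of the
  symmetric digraph.
\<close>

definition undirected_tree :: "'a pair_pre_digraph \<Rightarrow> bool" where
  "undirected_tree T \<longleftrightarrow> pair_graph T \<and> Digraph_Component.connected (with_proj T) \<and>
     \<not> (\<exists>p. pre_digraph.cycle (with_proj T) p \<and> length p \<ge> 3)"


section \<open>Unit-cost random access machine\<close>

text \<open>
  The machine has registers and an indirectly addressable memory, both holding natural numbers.
  Programs are structured (conditionals and loops instead of jumps). Every elementary instruction
  and every evaluation of a test costs one time unit. Addition and (truncated) subtraction are
  the only arithmetic operations; multiplication is deliberately not available at unit cost.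
\<close>

type_synonym reg = nat

datatype com =
    Const reg nat
  | Move reg reg
  | Add reg reg reg
  | Sub reg reg reg
  | Load reg reg
  | Store reg reg
  | Skip
  | Seq com com
  | IfLess reg reg com com
  | WhileLess reg reg com

type_synonym state = "(reg \<Rightarrow> nat) \<times> (nat \<Rightarrow> nat)"

text \<open>\<open>exec c s t s'\<close>: started in state \<open>s\<close>, program \<open>c\<close> halts in state \<open>s'\<close> after \<open>t\<close> time units.\<close>

inductive exec :: "com \<Rightarrow> state \<Rightarrow> nat \<Rightarrow> state \<Rightarrow> bool" where
  Const: "exec (Const x k) (r, m) 1 (r(x := k), m)"
| Move: "exec (Move x y) (r, m) 1 (r(x := r y), m)"
| Add: "exec (Add x y z) (r, m) 1 (r(x := r y + r z), m)"
| Sub: "exec (Sub x y z) (r, m) 1 (r(x := r y - r z), m)"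
| Load: "exec (Load x a) (r, m) 1 (r(x := m (r a)), m)"
| Store: "exec (Store a x) (r, m) 1 (r, m(r a := r x))"
| Skip: "exec Skip s 1 s"
| Seq: "exec c1 s1 t1 s2 \<Longrightarrow> exec c2 s2 t2 s3 \<Longrightarrow> exec (Seq c1 c2) s1 (t1 + t2) s3"
| IfTrue: "fst s x < fst s y \<Longrightarrow> exec c1 s t s' \<Longrightarrow> exec (IfLess x y c1 c2) s (1 + t) s'"
| IfFalse: "\<not> fst s x < fst s y \<Longrightarrow> exec c2 s t s' \<Longrightarrow> exec (IfLess x y c1 c2) s (1 + t) s'"
| WhileFalse: "\<not> fst s x < fst s y \<Longrightarrow> exec (WhileLess x y c) s 1 s"
| WhileTrue: "fst s1 x < fst s1 y \<Longrightarrow> exec c s1 t1 s2 \<Longrightarrow> exec (WhileLess x y c) s2 t2 s3 \<Longrightarrow>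
    exec (WhileLess x y c) s1 (1 + t1 + t2) s3"

inductive_cases exec_elims:
  "exec (Const x k) s t s'" "exec (Move x y) s t s'" "exec (Add x y z) s t s'"
  "exec (Sub x y z) s t s'" "exec (Load x a) s t s'" "exec (Store a x) s t s'"
  "exec Skip s t s'" "exec (Seq c1 c2) s t s'" "exec (IfLess x y c1 c2) s t s'"
inductive_cases exec_While_elim: "exec (WhileLess x y c) s t s'"

text \<open>Execution is deterministic, so the running time and the result are well defined.\<close>

lemma exec_deterministic:
  "exec c s t s' \<Longrightarrow> exec c s u s'' \<Longrightarrow> u = t \<and> s'' = s'"
proof (induction arbitrary: u s'' rule: exec.induct)
  case (Seq c1 s1 t1 s2 c2 t2 s3)
  from Seq.prems show ?case by (rule exec_elims(8)) (use Seq.IH in \<open>metis add_Suc plus_1_eq_Suc\<close>)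
next
  case (IfTrue s x y c1 t s' c2)
  from IfTrue.prems show ?case by (rule exec_elims(9)) (use IfTrue.hyps IfTrue.IH in \<open>metis add_Suc plus_1_eq_Suc\<close>)+
next
  case (IfFalse s x y c2 t s' c1)
  from IfFalse.prems show ?case by (rule exec_elims(9)) (use IfFalse.hyps IfFalse.IH in \<open>metis add_Suc plus_1_eq_Suc\<close>)+
next
  case (WhileFalse s x y c)
  from WhileFalse.prems show ?case by (rule exec_While_elim) (use WhileFalse.hyps in simp_all)+
next
  case (WhileTrue s1 x y c t1 s2 t2 s3)
  from WhileTrue.prems show ?case
    by (rule exec_While_elim) (use WhileTrue.hyps WhileTrue.IH in \<open>metis add_Suc plus_1_eq_Suc\<close>)+
qed (auto elim: exec_elims)


section \<open>Input and output conventions\<close>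

text \<open>
  The tree is presented by its list of edges, in arbitrary order, each edge occurring exactly once
  and in an arbitrary one of its two orientations.
\<close>

definition edge_list :: "'a pair_pre_digraph \<Rightarrow> ('a \<times> 'a) list \<Rightarrow> bool" where
  "edge_list T es \<longleftrightarrow> parcs T = set es \<union> (set es)\<inverse> \<and> set es \<inter> (set es)\<inverse> = {} \<and> distinct es"

text \<open>
  Initially register 0 holds the order $n$. The memory holds the weights of the vertices
  $0,\dots,n-1$, followed by the two endpoints of each edge. All other cells are 0.
\<close>

definition input_cells :: "nat \<Rightarrow> (nat \<Rightarrow> nat) \<Rightarrow> (nat \<times> nat) list \<Rightarrow> nat list" where
  "input_cells n w es = map w [0..<n] @ concat (map (\<lambda>(u, v). [u, v]) es)"

definition initial_state :: "nat \<Rightarrow> (nat \<Rightarrow> nat) \<Rightarrow> (nat \<times> nat) list \<Rightarrow> state" where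
  "initial_state n w es =
     ((\<lambda>_. 0)(0 := n),
      (\<lambda>a. if a < length (input_cells n w es) then input_cells n w es ! a else 0))"

text \<open>On halting, the first $n$ memory cells hold the characteristic vector of the computed set.\<close>

definition output_set :: "nat \<Rightarrow> state \<Rightarrow> nat set \<Rightarrow> bool" where
  "output_set n s S \<longleftrightarrow> S \<subseteq> {0..<n} \<and> (\<forall>v<n. snd s v = (if v \<in> S then 1 else 0))"

end

theory Submission
  imports Defs
begin

text \<open>
  Repeatedly remove from $A = V(T)$ a leaf $v$ of $T[A]$ whose branch (the part of $T$ hanging at $v$, including
  $v$) has minimum weight $b(v)$, as long as $2 b(v) \<le> w(A)$. Branch weights of removed leaves never exceed
  those of the current leaves, and the test keeps them at most $w(A)$ after the removal, so $A$ stays safe.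
  At the end every leaf $l$ of $T[A]$ has $w(A) < 2 b(l)$.
  Let $S$ be an optimal set. If $A \<subseteq> S$, or if $A$ misses $S$ and hence lies in a component of $T - S$, then
  $w(A) \<le> w(S)$. Otherwise some leaf $l$ of $T[A]$ is not in $S$, its branch lies in a component of
  $T - S$, and $w(A) < 2 b(l) \<le> 2 w(S)$.
  A round recomputes all degrees in $T[A]$ from the edge list in linear time, and there are at most $n$ rounds.
\<close>

section \<open>Pruning leaves\<close>

text \<open>For connected \<open>S\<close> in a connected graph, safety says just that every
  connected set outside \<open>S\<close> weighs at most w(S); the pruning argument uses safety only
  in this form. The bound w(A) alone is not inductive: removing \<open>v\<close> lowers w(A), and
  the branches cut off earlier must still fit. So the invariant also bounds every connected set
  outside \<open>A\<close> by the branch weight of each leaf. Taking a leaf \<open>v\<close> of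
  minimum branch weight preserves this, as the only leaf that can be new is the neighbour of
  \<open>v\<close>, whose branch swallows that of \<open>v\<close>. After the removal all outside
  sets weigh at most b(v), so one comparison of b(v) with w(A) covers them all. Safety itself would
  need only b(v) + w(v) \<le> w(A). Since w(v) \<le> b(v), the test 2 b(v) \<le> w(A) implies this,
  and its failure is the source of the factor 2. The assignment of vertices to branches exists only
  in the proof; the machine keeps just the branch weights, adding b(v) to that of the neighbour of
  \<open>v\<close>.\<close>

text \<open>
  Connectedness by cuts avoids all path manipulations. Likewise, the only consequence of acyclicity that
  is needed is that every edge is the only one across some cut.
\<close>

definition conn :: "('a \<times> 'a) set \<Rightarrow> 'a set \<Rightarrow> bool" where
  "conn R S \<longleftrightarrow> S \<noteq> {} \<and>
     (\<forall>X. X \<subseteq> S \<and> X \<noteq> {} \<and> X \<noteq> S \<longrightarrow> (\<exists>x\<in>X. \<exists>y\<in>S - X. (x, y) \<in> R))"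

definition nbrs :: "('a \<times> 'a) set \<Rightarrow> 'a set \<Rightarrow> 'a \<Rightarrow> 'a set" where
  "nbrs R A x = {y \<in> A. (x, y) \<in> R}"

definition leaf :: "('a \<times> 'a) set \<Rightarrow> 'a set \<Rightarrow> 'a \<Rightarrow> bool" where
  "leaf R A l \<longleftrightarrow> l \<in> A \<and> card (nbrs R A l) = 1"

text \<open>The cut is given by a predicate, so that reachability, membership in a set or the value
  of \<open>rep\<close> can be plugged in directly. This replaces following a path until the
  property first fails.\<close>

lemma connD:
  assumes "conn R S" "x \<in> S" "P x" "y \<in> S" "\<not> P y"
  obtains a b where "a \<in> S" "P a" "b \<in> S" "\<not> P b" "(a, b) \<in> R"
proof -
  let ?X = "{z \<in> S. P z}"
  have "?X \<subseteq> S \<and> ?X \<noteq> {} \<and> ?X \<noteq> S" using assms(2-5) by auto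
  moreover have "?X \<subseteq> S \<and> ?X \<noteq> {} \<and> ?X \<noteq> S \<longrightarrow> (\<exists>a\<in>?X. \<exists>b\<in>S - ?X. (a, b) \<in> R)"
    using conjunct2[OF assms(1)[unfolded conn_def]] by (rule spec)
  ultimately have "\<exists>a\<in>?X. \<exists>b\<in>S - ?X. (a, b) \<in> R" by (rule rev_mp)
  then show ?thesis using that by blast
qed

lemma connI:
  assumes "S \<noteq> {}"
    and "\<And>X x y. X \<subseteq> S \<Longrightarrow> x \<in> X \<Longrightarrow> y \<in> S \<Longrightarrow> y \<notin> X \<Longrightarrow> \<exists>a\<in>X. \<exists>b\<in>S - X. (a, b) \<in> R"
  shows "conn R S"
  unfolding conn_def using assms by blast

text \<open>A cut of the union splits \<open>A\<close>, or splits \<open>B\<close>, or has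
  \<open>a\<close> and \<open>b\<close> on different sides; in the last case the arc between them
  crosses it, in the orientation that symmetry supplies.\<close>

lemma conn_Un:
  assumes "sym R" "conn R A" "conn R B" "a \<in> A" "b \<in> B" "(a, b) \<in> R"
  shows "conn R (A \<union> B)"
proof (rule connI)
  show "A \<union> B \<noteq> {}" using assms by auto
next
  fix X x y assume X: "X \<subseteq> A \<union> B" "x \<in> X" "y \<in> A \<union> B" "y \<notin> X"
  have ba: "(b, a) \<in> R" using assms by (meson symD)
  show "\<exists>a\<in>X. \<exists>b\<in>A \<union> B - X. (a, b) \<in> R"
  proof (cases "a \<in> X \<longleftrightarrow> b \<in> X")
    case False
    then show ?thesis using assms ba by auto
  next
    case True
    have "(\<exists>u\<in>A. u \<in> X) \<and> (\<exists>u\<in>A. u \<notin> X) \<or> (\<exists>u\<in>B. u \<in> X) \<and> (\<exists>u\<in>B. u \<notin> X)"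
      using True X assms(4,5) by blast
    then show ?thesis
    proof
      assume "(\<exists>u\<in>A. u \<in> X) \<and> (\<exists>u\<in>A. u \<notin> X)"
      then obtain u v where "u \<in> A" "u \<in> X" "v \<in> A" "v \<notin> X" by blast
      from connD[OF assms(2), of u "\<lambda>z. z \<in> X" v, OF this] show ?thesis by blast
    next
      assume "(\<exists>u\<in>B. u \<in> X) \<and> (\<exists>u\<in>B. u \<notin> X)"
      then obtain u v where "u \<in> B" "u \<in> X" "v \<in> B" "v \<notin> X" by blast
      from connD[OF assms(3), of u "\<lambda>z. z \<in> X" v, OF this] show ?thesis by blast
    qed
  qed
qed

lemma conn_singleton: "conn R {x}"
  unfolding conn_def by auto

lemma nbrs_leaf: "leaf R A v \<Longrightarrow> \<exists>p. nbrs R A v = {p}"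
  unfolding leaf_def by (auto simp: card_1_singleton_iff)

lemma conn_remove_leaf:
  assumes R: "sym R" "irrefl R" and A: "conn R A" and v: "leaf R A v"
  shows "conn R (A - {v})"
proof -
  obtain p where p: "nbrs R A v = {p}" using nbrs_leaf[OF v] by blast
  have pA: "p \<in> A" "(v, p) \<in> R" using p unfolding nbrs_def by auto
  have pv: "p \<noteq> v" using pA R(2) by (auto simp: irrefl_def)
  show ?thesis
  proof (rule connI)
    show "A - {v} \<noteq> {}" using pA pv by auto
  next
    fix X x y assume X: "X \<subseteq> A - {v}" "x \<in> X" "y \<in> A - {v}" "y \<notin> X"
    have only: "z = p" if "z \<in> A" "(v, z) \<in> R \<or> (z, v) \<in> R" for z
      using that p R(1) unfolding nbrs_def by (metis (mono_tags, lifting) mem_Collect_eq singletonD symD)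
    \<comment> \<open>\<open>v\<close> is put on the side of its only neighbour \<open>p\<close>, so
      that neither arc between them crosses; the crossing arc then lies in
      \<open>A - {v}\<close>.\<close>
    define P where "P z \<longleftrightarrow> z \<in> X \<or> (z = v \<and> p \<in> X)" for z
    obtain a b where ab: "a \<in> A" "P a" "b \<in> A" "\<not> P b" "(a, b) \<in> R"
      by (rule connD[OF A, of x P y]) (use X in \<open>auto simp: P_def\<close>)
    have "a \<noteq> v" using ab only[of b] X(1) by (auto simp: P_def)
    moreover have "b \<noteq> v" using ab only[of a] X(1) calculation by (auto simp: P_def)
    ultimately show "\<exists>a\<in>X. \<exists>b\<in>A - {v} - X. (a, b) \<in> R" using ab by (auto simp: P_def)
  qed
qed

section \<open>Trees through their bridge cuts\<close>

locale bridge_tree =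
  fixes V :: "'a set" and R :: "('a \<times> 'a) set"
  assumes finV: "finite V" and symR: "sym R" and irreflR: "irrefl R" and RV: "R \<subseteq> V \<times> V"
    and connV: "conn R V"
    and bridge: "(u, v) \<in> R \<Longrightarrow>
      \<exists>X. u \<in> X \<and> v \<notin> X \<and> (\<forall>x y. (x, y) \<in> R \<and> x \<in> X \<and> y \<notin> X \<longrightarrow> x = u \<and> y = v)"
begin

definition cut :: "'a \<Rightarrow> 'a \<Rightarrow> 'a set \<Rightarrow> bool" where
  "cut u v X \<longleftrightarrow> u \<in> X \<and> v \<notin> X \<and> (\<forall>x y. (x, y) \<in> R \<and> x \<in> X \<and> y \<notin> X \<longrightarrow> x = u \<and> y = v)"

text \<open>Stepping from \<open>l\<close> to a neighbour other than \<open>p\<close> shrinks the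
  far side. Otherwise some arc leaves \<open>Y - X\<close>. If it ends in \<open>X\<close>, it joins
  \<open>p\<close> to \<open>l\<close> and also leaves \<open>Y\<close>, which forces
  \<open>q = p\<close>; if not, it leaves \<open>Y\<close> and so ends in \<open>l\<close>, which
  lies in \<open>X\<close>. The vertex \<open>l\<close> makes the inclusion strict.\<close>

lemma cut_psubset:
  assumes X: "cut l p X" and Y: "cut q l Y" and ql: "(q, l) \<in> R" and qp: "q \<noteq> p"
  shows "Y \<inter> V \<subset> X \<inter> V"
proof -
  have lX: "l \<in> X" "l \<notin> Y" using X Y by (auto simp: cut_def)
  have lV: "l \<in> V" using ql RV by auto
  have "Y \<inter> V \<subseteq> X"
  proof (rule ccontr)
    assume "\<not> Y \<inter> V \<subseteq> X"
    then obtain z where z: "z \<in> V" "z \<in> Y \<and> z \<notin> X" by auto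
    obtain a b where ab: "a \<in> Y \<and> a \<notin> X" "\<not> (b \<in> Y \<and> b \<notin> X)" "(a, b) \<in> R"
      by (rule connD[OF connV, of z "\<lambda>z. z \<in> Y \<and> z \<notin> X" l]) (use z lX lV in auto)
    have ba: "(b, a) \<in> R" using ab symR by (meson symD)
    show False
    proof (cases "b \<in> X")
      case True
      then have "b = l \<and> a = p" using X ab ba by (auto simp: cut_def)
      then have "a = q" using Y ab lX by (auto simp: cut_def)
      then show False using \<open>b = l \<and> a = p\<close> qp by auto
    next
      case False
      then have "b \<notin> Y" using ab by auto
      then have "b = l" using Y ab by (auto simp: cut_def)
      then show False using False lX by auto
    qed
  qed
  then show ?thesis using lX lV by auto
qed

text \<open>
  Among the edges from \<open>p\<close> to \<open>l\<close> inside \<open>A\<close> whose far side misses \<open>S\<close>, one with the smallest far side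
  has a leaf as its end \<open>l\<close>.
\<close>

lemma leaf_avoiding:
  assumes A: "conn R A" "A \<subseteq> V" and S: "conn R S" and ne: "A \<inter> S \<noteq> {}" "\<not> A \<subseteq> S"
  shows "\<exists>l. leaf R A l \<and> l \<notin> S"
proof -
  \<comment> \<open>A cut may contain points outside \<open>V\<close>; only its trace on
    \<open>V\<close> is known to be finite and can be measured.\<close>
  define Q where "Q n \<longleftrightarrow> (\<exists>l p X. l \<in> A \<and> p \<in> A \<and> (l, p) \<in> R \<and> cut l p X \<and> X \<inter> V \<inter> S = {} \<and> n = card (X \<inter> V))" for n
  obtain s t where st: "s \<in> A" "s \<in> S" "t \<in> A" "t \<notin> S" using ne by blast
  obtain p l where pl: "p \<in> A" "p \<in> S" "l \<in> A" "l \<notin> S" "(p, l) \<in> R"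
    by (rule connD[OF A(1), of s "\<lambda>z. z \<in> S" t]) (use st in auto)
  have lp: "(l, p) \<in> R" using pl symR by (meson symD)
  obtain X where X: "cut l p X" using bridge[OF lp] unfolding cut_def by blast
  \<comment> \<open>\<open>p\<close> lies in \<open>S\<close> but not in \<open>X\<close>, so a
    point of \<open>S\<close> in \<open>X\<close> would give an arc inside \<open>S\<close> leaving
    \<open>X\<close>. That arc starts in \<open>l\<close>, which is not in \<open>S\<close>.\<close>
  have "X \<inter> S = {}"
  proof (rule ccontr)
    assume "X \<inter> S \<noteq> {}"
    then obtain x where x: "x \<in> X" "x \<in> S" by blast
    have "p \<notin> X" using X by (auto simp: cut_def)
    obtain a b where ab: "a \<in> S" "a \<in> X" "b \<in> S" "b \<notin> X" "(a, b) \<in> R"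
      by (rule connD[OF S, of x "\<lambda>z. z \<in> X" p]) (use x pl \<open>p \<notin> X\<close> in auto)
    then have "a = l" using X by (auto simp: cut_def)
    then show False using ab pl by auto
  qed
  then have "Q (card (X \<inter> V))" unfolding Q_def using pl lp X by blast
  then have Q: "Q (LEAST n. Q n)" and least: "\<And>m. Q m \<Longrightarrow> (LEAST n. Q n) \<le> m"
    by (auto intro: LeastI Least_le)
  from Q obtain l p X where l: "l \<in> A" "p \<in> A" "(l, p) \<in> R" and X: "cut l p X" "X \<inter> V \<inter> S = {}"
    and n: "(LEAST n. Q n) = card (X \<inter> V)" unfolding Q_def by blast
  have uniq: "q = p" if q: "q \<in> A" "(l, q) \<in> R" for q
  proof (rule ccontr)
    assume qp: "q \<noteq> p"
    have ql: "(q, l) \<in> R" using q symR by (meson symD)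
    obtain Y where Y: "cut q l Y" using bridge[OF ql] unfolding cut_def by blast
    have sub: "Y \<inter> V \<subset> X \<inter> V" using cut_psubset[OF X(1) Y ql qp] .
    then have "Q (card (Y \<inter> V))" unfolding Q_def using l q ql Y X by blast
    moreover have "card (Y \<inter> V) < card (X \<inter> V)" using sub finV by (intro psubset_card_mono) auto
    ultimately show False using least n by fastforce
  qed
  have "nbrs R A l = {p}" unfolding nbrs_def using l by (blast dest: uniq)
  then have "leaf R A l" using l unfolding leaf_def by auto
  moreover have "l \<notin> S" using X l A by (auto simp: cut_def)
  ultimately show ?thesis by blast
qed

lemma leaf_exists:
  assumes "conn R A" "A \<subseteq> V" "card A \<noteq> 1"
  shows "\<exists>l. leaf R A l"
proof -
  obtain x where x: "x \<in> A" using assms(1) by (auto simp: conn_def)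
  have "\<not> A \<subseteq> {x}" using assms(3) x by (auto simp: subset_singleton_iff)
  then show ?thesis using leaf_avoiding[OF assms(1,2) conn_singleton[of R x]] x by auto
qed

text \<open>The machine receives only \<open>n\<close>, so its edge loop must get the number of
  edges from \<open>n\<close>. Removing a leaf deletes exactly the two arcs between it and its
  neighbour.\<close>

lemma card_arcs:
  assumes "conn R A" "A \<subseteq> V"
  shows "card (R \<inter> A \<times> A) = 2 * (card A - 1)"
  using assms
proof (induction "card A" arbitrary: A rule: less_induct)
  case less
  have fin: "finite A" using less.prems finV finite_subset by blast
  show ?case
  proof (cases "card A = 1")
    case True
    then obtain x where "A = {x}" by (auto simp: card_1_singleton_iff)
    then have "R \<inter> A \<times> A = {}" using irreflR by (auto simp: irrefl_def)
    then show ?thesis using True by auto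
  next
    case False
    then obtain v where v: "leaf R A v" using leaf_exists less.prems by blast
    then obtain p where p: "nbrs R A v = {p}" using nbrs_leaf by metis
    have pA: "p \<in> A" "(v, p) \<in> R" "v \<in> A" using p v unfolding nbrs_def leaf_def by auto
    have pv: "p \<noteq> v" "(p, v) \<in> R" using pA irreflR symR by (auto simp: irrefl_def dest: symD)
    have c: "card (A - {v}) = card A - 1" using fin pA by auto
    have pos: "card A > 1" proof -
      have "card A > 0" using fin pA by (auto simp: card_gt_0_iff)
      then show ?thesis using False by linarith
    qed
    have IH: "card (R \<inter> (A - {v}) \<times> (A - {v})) = 2 * (card (A - {v}) - 1)"
      using less.hyps[of "A - {v}"] conn_remove_leaf[OF symR irreflR less.prems(1) v] less.prems pos c
      by auto
    have only: "z = p" if "z \<in> A" "(v, z) \<in> R \<or> (z, v) \<in> R" for z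
      using that p symR unfolding nbrs_def by (metis (mono_tags, lifting) mem_Collect_eq singletonD symD)
    have eq: "R \<inter> A \<times> A = insert (v, p) (insert (p, v) (R \<inter> (A - {v}) \<times> (A - {v})))"
    proof (rule set_eqI)
      fix e :: "'a \<times> 'a"
      obtain x y where e: "e = (x, y)" by fastforce
      show "e \<in> R \<inter> A \<times> A \<longleftrightarrow> e \<in> insert (v, p) (insert (p, v) (R \<inter> (A - {v}) \<times> (A - {v})))"
        unfolding e using pA pv only[of x] only[of y] by blast
    qed
    have "card (R \<inter> A \<times> A) = 2 + card (R \<inter> (A - {v}) \<times> (A - {v}))"
      unfolding eq using fin pv by (subst card_insert_disjoint; (subst card_insert_disjoint)?) auto
    then show ?thesis using IH c pos by auto
  qed
qed

text \<open>
  \<open>rep x\<close> is the vertex of \<open>A\<close> whose branch contains \<open>x\<close>, and \<open>acc a\<close> the weight of the branch of \<open>a\<close>.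
\<close>

definition pruned :: "('a \<Rightarrow> nat) \<Rightarrow> 'a set \<Rightarrow> ('a \<Rightarrow> nat) \<Rightarrow> ('a \<Rightarrow> 'a) \<Rightarrow> bool" where
  "pruned w A acc rep \<longleftrightarrow> A \<subseteq> V \<and> conn R A \<and> (\<forall>a\<in>A. rep a = a) \<and> (\<forall>x\<in>V. rep x \<in> A) \<and>
     (\<forall>a\<in>A. conn R {x \<in> V. rep x = a} \<and> acc a = sum w {x \<in> V. rep x = a}) \<and>
     (\<forall>x y. (x, y) \<in> R \<longrightarrow> rep x = rep y \<or> x \<in> A \<and> y \<in> A) \<and>
     (\<forall>D. D \<subseteq> V - A \<and> conn R D \<longrightarrow>
        sum w D \<le> sum w A \<and> (\<forall>l. leaf R A l \<longrightarrow> sum w D \<le> acc l))"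

lemma pruned_initial: "pruned w V w (\<lambda>x. x)"
proof -
  have eq: "{x \<in> V. x = a} = {a}" if "a \<in> V" for a using that by auto
  have "\<not> (D \<subseteq> V - V \<and> conn R D)" for D by (auto simp: conn_def)
  moreover have "conn R {x \<in> V. x = a} \<and> w a = sum w {x \<in> V. x = a}" if "a \<in> V" for a
    unfolding eq[OF that] using conn_singleton by simp
  moreover have "x \<in> V \<and> y \<in> V" if "(x, y) \<in> R" for x y using that RV by blast
  ultimately show ?thesis unfolding pruned_def using connV by simp
qed

lemma prunedD:
  assumes "pruned w A acc rep"
  shows "A \<subseteq> V" "conn R A" "\<And>a. a \<in> A \<Longrightarrow> rep a = a" "\<And>x. x \<in> V \<Longrightarrow> rep x \<in> A"
    "\<And>a. a \<in> A \<Longrightarrow> conn R {x \<in> V. rep x = a}"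
    "\<And>a. a \<in> A \<Longrightarrow> acc a = sum w {x \<in> V. rep x = a}"
    "\<And>x y. (x, y) \<in> R \<Longrightarrow> rep x = rep y \<or> x \<in> A \<and> y \<in> A"
    "\<And>D. D \<subseteq> V - A \<Longrightarrow> conn R D \<Longrightarrow> sum w D \<le> sum w A"
    "\<And>D l. D \<subseteq> V - A \<Longrightarrow> conn R D \<Longrightarrow> leaf R A l \<Longrightarrow> sum w D \<le> acc l"
  using assms unfolding pruned_def by simp_all

lemma prunedI:
  assumes "A \<subseteq> V" "conn R A" "\<And>a. a \<in> A \<Longrightarrow> rep a = a" "\<And>x. x \<in> V \<Longrightarrow> rep x \<in> A"
    "\<And>a. a \<in> A \<Longrightarrow> conn R {x \<in> V. rep x = a} \<and> acc a = sum w {x \<in> V. rep x = a}"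
    "\<And>x y. (x, y) \<in> R \<Longrightarrow> rep x = rep y \<or> x \<in> A \<and> y \<in> A"
    "\<And>D. D \<subseteq> V - A \<and> conn R D \<Longrightarrow>
       sum w D \<le> sum w A \<and> (\<forall>l. leaf R A l \<longrightarrow> sum w D \<le> acc l)"
  shows "pruned w A acc rep"
  unfolding pruned_def using assms by simp

lemma pruned_step:
  assumes inv: "pruned w A acc rep" and v: "leaf R A v" and p: "nbrs R A v = {p}"
    and min: "\<And>l. leaf R A l \<Longrightarrow> acc v \<le> acc l" and heavy: "2 * acc v \<le> sum w A"
  shows "pruned w (A - {v}) (acc(p := acc p + acc v)) (\<lambda>x. if rep x = v then p else rep x)"
proof -
  note A = prunedD(1,2)[OF inv] and repA = prunedD(3)[OF inv] and repV = prunedD(4)[OF inv]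
    and br = prunedD(5)[OF inv] and acc = prunedD(6)[OF inv] and arc = prunedD(7)[OF inv]
    and out = prunedD(9)[OF inv]
  have pA: "p \<in> A" "(v, p) \<in> R" "v \<in> A" using p v unfolding nbrs_def leaf_def by auto
  have pv: "p \<noteq> v" "(p, v) \<in> R" using pA irreflR symR by (auto simp: irrefl_def dest: symD)
  have only: "z = p" if "z \<in> A" "(z, v) \<in> R" for z
    using that p symR unfolding nbrs_def by (metis (mono_tags, lifting) mem_Collect_eq singletonD symD)
  let ?rep = "\<lambda>x. if rep x = v then p else rep x" and ?acc = "acc(p := acc p + acc v)"
  have finA: "finite A" using A finV finite_subset by blast
  have bp: "{x \<in> V. ?rep x = p} = {x \<in> V. rep x = p} \<union> {x \<in> V. rep x = v}" by auto
  have ba: "{x \<in> V. ?rep x = a} = {x \<in> V. rep x = a}" if "a \<in> A - {v}" "a \<noteq> p" for a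
    using that by auto
  have "conn R {x \<in> V. ?rep x = p}" unfolding bp
    by (rule conn_Un[OF symR br[OF pA(1)] br[OF pA(3)], of p v]) (use pA pv repA A in auto)
  moreover have "?acc p = sum w {x \<in> V. ?rep x = p}" unfolding bp
    using pv finV acc pA by (subst sum.union_disjoint) auto
  ultimately have branch: "conn R {x \<in> V. ?rep x = a} \<and> ?acc a = sum w {x \<in> V. ?rep x = a}"
    if "a \<in> A - {v}" for a
    using ba[OF that] br acc that by (cases "a = p") auto
  have wv: "w v \<le> acc v" unfolding acc[OF pA(3)]
    using A repA pA finV by (intro member_le_sum) auto
  have wA: "sum w A = w v + sum w (A - {v})" by (rule sum.remove[OF finA pA(3)])
  \<comment> \<open>If \<open>D\<close> avoids \<open>v\<close>, the old invariant at the leaf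
    \<open>v\<close> applies. If it contains \<open>v\<close>, it cannot leave the branch of
    \<open>v\<close>: an arc between branches joins two vertices of \<open>A\<close>, and
    \<open>v\<close> is the only vertex of \<open>A\<close> in \<open>D\<close>.\<close>
  have small: "sum w D \<le> acc v" if D: "D \<subseteq> V - (A - {v})" "conn R D" for D
  proof (cases "v \<in> D")
    case False
    then show ?thesis using out[OF _ D(2) v] D by auto
  next
    case True
    have "D \<subseteq> {x \<in> V. rep x = v}"
    proof (rule ccontr)
      assume "\<not> ?thesis"
      then obtain y where y: "y \<in> D" "rep y \<noteq> v" using D by auto
      obtain a b where "a \<in> D" "rep a = v" "b \<in> D" "rep b \<noteq> v" "(a, b) \<in> R"
        by (rule connD[OF D(2), of v "\<lambda>z. rep z = v" y]) (use y True repA pA in auto)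
      then show False using arc[of a b] D repA pA by auto
    qed
    then show ?thesis unfolding acc[OF pA(3)] using finV by (intro sum_mono2) auto
  qed
  \<comment> \<open>A leaf other than \<open>p\<close> is not adjacent to \<open>v\<close>, so it
    was a leaf before; for \<open>p\<close>, the new value contains \<open>acc v\<close>.\<close>
  have lf: "acc v \<le> ?acc l" if l: "leaf R (A - {v}) l" for l
  proof (cases "l = p")
    case False
    have lA: "l \<in> A" using l by (auto simp: leaf_def)
    then have "(l, v) \<notin> R" using False only by auto
    then have "nbrs R (A - {v}) l = nbrs R A l" unfolding nbrs_def by auto
    then have "leaf R A l" using l lA unfolding leaf_def by auto
    then show ?thesis using min False by auto
  qed auto
  show ?thesis
  proof (rule prunedI)
    show "A - {v} \<subseteq> V" using A by auto
    show "conn R (A - {v})" by (rule conn_remove_leaf[OF symR irreflR A(2) v])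
    show "?rep a = a" if "a \<in> A - {v}" for a using that repA by auto
    show "?rep x \<in> A - {v}" if "x \<in> V" for x using repV[OF that] pA pv by auto
    show "conn R {x \<in> V. ?rep x = a} \<and> ?acc a = sum w {x \<in> V. ?rep x = a}" if "a \<in> A - {v}" for a
      by (rule branch[OF that])
    show "sum w D \<le> sum w (A - {v}) \<and> (\<forall>l. leaf R (A - {v}) l \<longrightarrow> sum w D \<le> ?acc l)"
      if "D \<subseteq> V - (A - {v}) \<and> conn R D" for D
    proof -
      have D: "sum w D \<le> acc v" using small that by blast
      \<comment> \<open>\<open>sum w A - w v\<close> is at least
        \<open>2 * acc v - acc v\<close>.\<close>
      then have "sum w D \<le> sum w (A - {v})" using heavy wv wA by linarith
      then show ?thesis using D lf by (meson order_trans)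
    qed
    show "?rep x = ?rep y \<or> x \<in> A - {v} \<and> y \<in> A - {v}" if xy: "(x, y) \<in> R" for x y
    proof -
      have yx: "(y, x) \<in> R" using xy symR by (meson symD)
      \<comment> \<open>The only edge inside \<open>A\<close> at \<open>v\<close> leads to
        \<open>p\<close>, and both its ends are now represented by \<open>p\<close>.\<close>
      have "?rep x = ?rep y" if "x = v \<or> y = v" "x \<in> A" "y \<in> A"
        using that only[of x] only[of y] xy yx repA[of x] repA[of y] pv(1) by metis
      then show ?thesis using arc[OF xy] by auto
    qed
  qed
qed

lemma pruned_two_approx:
  assumes inv: "pruned w A acc rep" and stop: "\<And>l. leaf R A l \<Longrightarrow> sum w A < 2 * acc l"
    and S: "conn R S" "S \<subseteq> V"
    and safe: "\<And>D. D \<subseteq> V - S \<Longrightarrow> conn R D \<Longrightarrow> sum w D \<le> sum w S"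
  shows "sum w A \<le> 2 * sum w S"
proof -
  note A = prunedD(1,2)[OF inv] and repA = prunedD(3)[OF inv]
    and br = prunedD(5)[OF inv] and acc = prunedD(6)[OF inv] and arc = prunedD(7)[OF inv]
  have finS: "finite S" using S finV finite_subset by blast
  consider "A \<subseteq> S" | "A \<inter> S = {}" | "A \<inter> S \<noteq> {}" "\<not> A \<subseteq> S" by blast
  then show ?thesis
  proof cases
    case 1
    then have "sum w A \<le> sum w S" using finS by (intro sum_mono2) auto
    then show ?thesis by auto
  next
    case 2
    then have "sum w A \<le> sum w S" using A by (intro safe) auto
    then show ?thesis by auto
  next
    case 3
    then obtain l where l: "leaf R A l" "l \<notin> S" using leaf_avoiding[OF A(2,1) S(1)] by blast
    let ?B = "{x \<in> V. rep x = l}"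
    have lA: "l \<in> A" using l by (auto simp: leaf_def)
    \<comment> \<open>\<open>S\<close> contains a vertex of \<open>A\<close> other than
      \<open>l\<close>, hence outside the branch. If \<open>S\<close> met the branch, an arc inside
      \<open>S\<close> would leave it; such an arc starts in a vertex of \<open>A\<close>
      represented by \<open>l\<close>, which is \<open>l\<close> itself and not in
      \<open>S\<close>.\<close>
    have "?B \<inter> S = {}"
    proof (rule ccontr)
      assume "?B \<inter> S \<noteq> {}"
      then obtain x where x: "x \<in> S" "rep x = l" by auto
      obtain s where s: "s \<in> A" "s \<in> S" using 3 by auto
      have "rep s \<noteq> l" using s l repA[of s] by auto
      obtain a b where ab: "a \<in> S" "rep a = l" "b \<in> S" "rep b \<noteq> l" "(a, b) \<in> R"
        by (rule connD[OF S(1), of x "\<lambda>z. rep z = l" s]) (use x s \<open>rep s \<noteq> l\<close> in auto)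
      then have "a \<in> A" using arc[of a b] by auto
      then show False using ab l repA[of a] by auto
    qed
    then have "sum w ?B \<le> sum w S" using br[OF lA] by (intro safe) auto
    moreover have "acc l = sum w ?B" by (rule acc[OF lA])
    ultimately show ?thesis using stop[OF l(1)] by linarith
  qed
qed

end

section \<open>Components and cycles of pair graphs\<close>

text \<open>Links cuts to the reachability of the library: no arc inside \<open>S\<close> leaves the
  set reachable from \<open>u\<close>, and a walk out of \<open>X\<close> must cross its
  border.\<close>

lemma conn_iff_rtrancl_on:
  "conn R S \<longleftrightarrow> S \<noteq> {} \<and> (\<forall>u\<in>S. \<forall>v\<in>S. (u, v) \<in> rtrancl_on S (R \<inter> S \<times> S))"
proof
  assume c: "conn R S"
  have "(u, v) \<in> rtrancl_on S (R \<inter> S \<times> S)" if uv: "u \<in> S" "v \<in> S" for u v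
  proof (rule ccontr)
    assume n: "(u, v) \<notin> rtrancl_on S (R \<inter> S \<times> S)"
    obtain a b where "a \<in> S" "(u, a) \<in> rtrancl_on S (R \<inter> S \<times> S)" "b \<in> S"
      "(u, b) \<notin> rtrancl_on S (R \<inter> S \<times> S)" "(a, b) \<in> R"
      by (rule connD[OF c, of u "\<lambda>z. (u, z) \<in> rtrancl_on S (R \<inter> S \<times> S)" v]) (use uv n in auto)
    then show False by (auto intro: rtrancl_on_into_rtrancl_on)
  qed
  then show "S \<noteq> {} \<and> (\<forall>u\<in>S. \<forall>v\<in>S. (u, v) \<in> rtrancl_on S (R \<inter> S \<times> S))"
    using c by (simp add: conn_def)
next
  assume r: "S \<noteq> {} \<and> (\<forall>u\<in>S. \<forall>v\<in>S. (u, v) \<in> rtrancl_on S (R \<inter> S \<times> S))"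
  show "conn R S"
  proof (rule connI)
    show "S \<noteq> {}" using r by simp
    fix X x y assume X: "X \<subseteq> S" "x \<in> X" "y \<in> S" "y \<notin> X"
    have "(x, y) \<in> rtrancl_on S (R \<inter> S \<times> S)" using r X by blast
    then have "y \<in> X \<or> (\<exists>a\<in>X. \<exists>b\<in>S - X. (a, b) \<in> R)"
      using X(2) by (induction rule: rtrancl_on_induct) auto
    then show "\<exists>a\<in>X. \<exists>b\<in>S - X. (a, b) \<in> R" using X by blast
  qed
qed

lemma induce_induce: "U \<subseteq> W \<Longrightarrow> (G \<restriction> W) \<restriction> U = G \<restriction> U"
  by (auto simp: induce_subgraph_def)

lemma arcs_ends_induce: "arcs_ends (with_proj T \<restriction> S) = parcs T \<inter> S \<times> S"
  by (auto simp: arcs_ends_conv induce_subgraph_def)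

lemma conn_iff_strongly_connected:
  "conn (parcs T) S \<longleftrightarrow> strongly_connected (with_proj T \<restriction> S)"
  by (simp add: conn_iff_rtrancl_on strongly_connected_def reachable_def arcs_ends_induce)

lemma conn_iff_connected_set:
  assumes "sym (parcs T)"
  shows "connected_set (with_proj T) S \<longleftrightarrow> conn (parcs T) S"
proof -
  have "(parcs T \<inter> S \<times> S)\<^sup>s = parcs T \<inter> S \<times> S"
    using assms by (auto simp: symcl_def dest: symD)
  then show ?thesis
    by (simp add: connected_set_def connected_conv arcs_ends_induce conn_iff_rtrancl_on)
qed

context pair_graph
begin

lemma sym_parcs: "sym (parcs G)"
  using sym_arcs by (simp add: symmetric_def)

lemma conn_sccs:
  assumes "D \<in> pre_digraph.sccs (with_proj G \<restriction> W)"
  shows "verts D \<subseteq> W" "conn (parcs G) (verts D)"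
proof -
  interpret W: wf_digraph "with_proj G \<restriction> W" by (rule wellformed_induce_subgraph)
  have ind: "induced_subgraph D (with_proj G \<restriction> W)" "strongly_connected D"
    using assms by (auto simp: W.sccs_def)
  show sub: "verts D \<subseteq> W"
    using induced_imp_subgraph[OF ind(1)] by (auto simp: subgraph_def)
  have "(with_proj G \<restriction> W) \<restriction> verts D = D" using W.induce_eq_iff_induced[OF ind(1)] .
  then have "D = with_proj G \<restriction> verts D" using induce_induce[OF sub] by metis
  then show "conn (parcs G) (verts D)" using ind(2) conn_iff_strongly_connected by metis
qed

lemma sccs_conn:
  assumes "conn (parcs G) S"
  shows "with_proj G \<restriction> S \<in> pre_digraph.sccs (with_proj G \<restriction> S)"
    and "C \<in> pre_digraph.sccs (with_proj G \<restriction> S) \<Longrightarrow> verts C = S"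
proof -
  interpret S: wf_digraph "with_proj G \<restriction> S" by (rule wellformed_induce_subgraph)
  have sc: "strongly_connected (with_proj G \<restriction> S)" using assms conn_iff_strongly_connected by metis
  have ind: "induced_subgraph (with_proj G \<restriction> S) (with_proj G \<restriction> S)" by (rule S.induced_subgraph_refl)
  have le: "verts H \<subseteq> S" if "induced_subgraph H (with_proj G \<restriction> S)" for H
    using induced_imp_subgraph[OF that] by (auto simp: subgraph_def)
  show "with_proj G \<restriction> S \<in> pre_digraph.sccs (with_proj G \<restriction> S)"
    using sc ind le by (fastforce simp: S.sccs_def)
  show "verts C = S" if "C \<in> pre_digraph.sccs (with_proj G \<restriction> S)"
  proof (rule ccontr)
    assume "verts C \<noteq> S"
    moreover have "induced_subgraph C (with_proj G \<restriction> S)" using that by (simp add: S.sccs_def)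
    ultimately have "verts C \<subset> verts (with_proj G \<restriction> S)" using le by auto
    then show False using that sc ind unfolding S.sccs_def by blast
  qed
qed

text \<open>The last property says that an arc leaving \<open>D\<close> leaves \<open>W\<close>.
  When \<open>W\<close> is the complement of \<open>S\<close> in a connected graph, it is what makes
  \<open>D\<close> adjacent to \<open>S\<close>.\<close>

lemma conn_subset_scc:
  assumes B: "conn (parcs G) B" "B \<subseteq> W"
  obtains D where "D \<in> pre_digraph.sccs (with_proj G \<restriction> W)" "B \<subseteq> verts D"
    "\<And>x y. x \<in> verts D \<Longrightarrow> y \<in> W \<Longrightarrow> (x, y) \<in> parcs G \<Longrightarrow> y \<in> verts D"
proof -
  interpret W: wf_digraph "with_proj G \<restriction> W" by (rule wellformed_induce_subgraph)
  obtain b where b: "b \<in> B" using B by (auto simp: conn_def)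
  let ?D = "W.scc_of b"
  have "?D \<in> W.sccs_verts" using b B by (intro W.scc_of_in_sccs_verts) auto
  then have D: "(with_proj G \<restriction> W) \<restriction> ?D \<in> W.sccs" by (rule W.in_verts_sccsD_sccs)
  have reach: "x \<rightarrow>\<^sup>*\<^bsub>with_proj G \<restriction> W\<^esub> y \<longleftrightarrow> (x, y) \<in> rtrancl_on W (parcs G \<inter> W \<times> W)" for x y
    by (simp add: reachable_def arcs_ends_induce)
  have 1: "B \<subseteq> ?D"
  proof
    fix x assume x: "x \<in> B"
    have "(b, x) \<in> rtrancl_on B (parcs G \<inter> B \<times> B)" "(x, b) \<in> rtrancl_on B (parcs G \<inter> B \<times> B)"
      using B(1) b x conn_iff_rtrancl_on by metis+
    moreover have "parcs G \<inter> B \<times> B \<subseteq> parcs G \<inter> W \<times> W" using B by auto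
    ultimately show "x \<in> ?D" unfolding W.scc_of_def reach
      using rtrancl_on_mono[OF _ B(2)] by blast
  qed
  have 2: "y \<in> ?D" if "x \<in> ?D" "y \<in> W" "(x, y) \<in> parcs G" for x y
  proof -
    have bx: "(b, x) \<in> rtrancl_on W (parcs G \<inter> W \<times> W)" "(x, b) \<in> rtrancl_on W (parcs G \<inter> W \<times> W)"
      using that(1) unfolding W.scc_of_def reach by auto
    then have xW: "x \<in> W" using in_rtrancl_on_in_F by metis
    have xy: "(x, y) \<in> parcs G \<inter> W \<times> W" "(y, x) \<in> parcs G \<inter> W \<times> W"
      using that xW sym_parcs by (auto dest: symD)
    show ?thesis unfolding W.scc_of_def reach
      using rtrancl_on_into_rtrancl_on[OF bx(1) xy(1)]
        converse_rtrancl_on_into_rtrancl_on[OF xy(2) bx(2)] that by blast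
  qed
  show thesis by (rule that[OF D]) (use 1 2 in auto)
qed

lemma connected_safe_set_iff:
  assumes V: "conn (parcs G) (pverts G)"
  shows "connected_safe_set (with_proj G) w S \<longleftrightarrow> S \<subseteq> pverts G \<and> conn (parcs G) S \<and>
    (\<forall>D. D \<subseteq> pverts G - S \<and> conn (parcs G) D \<longrightarrow> sum w D \<le> sum w S)" (is "?L \<longleftrightarrow> ?R")
proof
  assume ?L
  then have S: "S \<subseteq> pverts G" "conn (parcs G) S"
    and safe: "\<And>C D. C \<in> pre_digraph.sccs (with_proj G \<restriction> S) \<Longrightarrow>
      D \<in> pre_digraph.sccs (with_proj G \<restriction> (pverts G - S)) \<Longrightarrow>
      adjacent_subgraphs (with_proj G) C D \<Longrightarrow> sum w (verts C) \<ge> sum w (verts D)"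
    by (auto simp: connected_safe_set_def safe_set_def conn_iff_connected_set[OF sym_parcs])
  have "sum w B \<le> sum w S" if B: "B \<subseteq> pverts G - S" "conn (parcs G) B" for B
  proof -
    obtain D where D: "D \<in> pre_digraph.sccs (with_proj G \<restriction> (pverts G - S))" "B \<subseteq> verts D"
      "\<And>x y. x \<in> verts D \<Longrightarrow> y \<in> pverts G - S \<Longrightarrow> (x, y) \<in> parcs G \<Longrightarrow> y \<in> verts D"
      using conn_subset_scc[OF B(2,1)] by blast
    have DW: "verts D \<subseteq> pverts G - S" using conn_sccs(1)[OF D(1)] .
    obtain b where b: "b \<in> B" using B by (auto simp: conn_def)
    obtain s where s: "s \<in> S" using S by (auto simp: conn_def)
    obtain x y where xy: "x \<in> pverts G" "x \<in> verts D" "y \<in> pverts G" "y \<notin> verts D" "(x, y) \<in> parcs G"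
      by (rule connD[OF V, of b "\<lambda>z. z \<in> verts D" s]) (use b s D(2) B DW S in auto)
    have "y \<in> S" using D(3)[of x y] xy by blast
    then have "adjacent_subgraphs (with_proj G) (with_proj G \<restriction> S) D"
      using xy sym_parcs unfolding adjacent_subgraphs_def by (auto dest: symD)
    then have "sum w (verts D) \<le> sum w S" using safe[OF sccs_conn(1)[OF S(2)] D(1)] by simp
    moreover have "finite (verts D)" using DW pair_finite_verts finite_subset by blast
    then have "sum w B \<le> sum w (verts D)" using D(2) by (intro sum_mono2) auto
    ultimately show ?thesis by simp
  qed
  then show ?R using S by blast
next
  assume R: ?R
  have "sum w (verts D) \<le> sum w (verts C)"
    if "C \<in> pre_digraph.sccs (with_proj G \<restriction> S)"
      "D \<in> pre_digraph.sccs (with_proj G \<restriction> (pverts G - S))" for C D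
  proof -
    have "verts C = S" using sccs_conn(2) that R by blast
    then show ?thesis using conn_sccs[OF that(2)] R by simp
  qed
  then show ?L using R
    by (simp add: connected_safe_set_def safe_set_def conn_iff_connected_set[OF sym_parcs])
qed

text \<open>A path from \<open>u\<close> to \<open>v\<close> avoiding the edge \<open>uv\<close> has length at least 2, so the edge closes it to a long cycle.\<close>

lemma bridge_of_no_cycle:
  assumes nc: "\<not> (\<exists>p. pre_digraph.cycle (with_proj G) p \<and> length p \<ge> 3)" and uv: "(u, v) \<in> parcs G"
  shows "\<exists>X. u \<in> X \<and> v \<notin> X \<and> (\<forall>x y. (x, y) \<in> parcs G \<and> x \<in> X \<and> y \<notin> X \<longrightarrow> x = u \<and> y = v)"
proof -
  define R where "R = parcs G - {(u, v), (v, u)}"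
  define H where "H = \<lparr>pverts = pverts G, parcs = R\<rparr>"
  have [simp]: "pverts H = pverts G" "parcs H = R" by (simp_all add: H_def)
  interpret H: pair_wf_digraph H
    by unfold_locales (auto simp: R_def intro: in_arcsD1 in_arcsD2 wellformed)
  \<comment> \<open>\<open>?X\<close> is the side of \<open>u\<close> after both arcs of the edge
    are deleted. Kept arcs never leave it, and \<open>(v, u)\<close> does not start in it once
    \<open>v\<close> is shown to be outside.\<close>
  let ?X = "{x. u \<rightarrow>\<^sup>*\<^bsub>with_proj H\<^esub> x}"
  have uvV: "u \<in> pverts G" "v \<in> pverts G" "u \<noteq> v" "(v, u) \<in> parcs G"
    using uv in_arcsD1 in_arcsD2 pair_no_loops sym_parcs by (fastforce dest: symD)+
  have "v \<notin> ?X"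
  proof
    assume "v \<in> ?X"
    then obtain p where p: "H.apath u p v" by (auto simp: H.reachable_apath)
    then have hp: "u \<in> pverts G" "set p \<subseteq> R" "H.cas u p v" "distinct (H.awalk_verts u p)"
      by (auto simp: H.apath_def H.awalk_def)
    have aw: "awalk u p v" using hp by (auto simp: awalk_def R_def)
    have "awalk v ((v, u) # p) v" using aw uvV by (simp add: awalk_Cons_iff)
    moreover have "distinct (tl (awalk_verts v ((v, u) # p)))" using hp by simp
    ultimately have "cycle ((v, u) # p)" unfolding cycle_def by blast
    moreover have "length p \<ge> 2"
    proof (rule ccontr)
      assume "\<not> length p \<ge> 2"
      then consider "p = []" | e where "p = [e]" by (cases p; cases "tl p") auto
      then show False using hp uvV by cases (auto simp: R_def)
    qed
    ultimately show False using nc by auto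
  qed
  moreover have "u \<in> ?X" using uvV by auto
  moreover have "x = u \<and> y = v" if xy: "(x, y) \<in> parcs G" "x \<in> ?X" "y \<notin> ?X" for x y
  proof (rule ccontr)
    assume n: "\<not> (x = u \<and> y = v)"
    show False
    proof (cases "x = v \<and> y = u")
      case True then show False using xy \<open>v \<notin> ?X\<close> by simp
    next
      case False
      then have "(x, y) \<in> R" using n xy by (auto simp: R_def)
      then have "u \<rightarrow>\<^sup>*\<^bsub>with_proj H\<^esub> y" using xy(2) H.reachable_adj_trans by auto
      then show False using xy by simp
    qed
  qed
  ultimately show ?thesis by blast
qed

end

lemma bridge_tree_undirected_tree:
  assumes "undirected_tree T"
  shows "bridge_tree (pverts T) (parcs T)"
proof -
  interpret pair_graph T using assms by (simp add: undirected_tree_def)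
  have "with_proj T \<restriction> pverts T = with_proj T"
    by (auto simp: induce_subgraph_def with_proj_def dest: in_arcsD1 in_arcsD2)
  then have "conn (parcs T) (pverts T)"
    using assms conn_iff_connected_set[OF sym_parcs, of "pverts T"]
    by (simp add: undirected_tree_def connected_set_def)
  moreover have "parcs T \<subseteq> pverts T \<times> pverts T" using in_arcsD1 in_arcsD2 by auto
  moreover have "irrefl (parcs T)" using pair_no_loops by (fastforce simp: irrefl_def)
  ultimately show ?thesis
    using bridge_of_no_cycle assms pair_finite_verts sym_parcs
    by unfold_locales (simp_all add: undirected_tree_def)
qed

text \<open>\<open>Min\<close> in \<open>cs\<close> is meaningful because the set is finite and not
  empty: the whole vertex set is safe, as nothing lies outside it.\<close>

lemma cs_attained:
  assumes "undirected_tree T"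
  obtains S where "connected_safe_set (with_proj T) w S" "cs (with_proj T) w = sum w S"
proof -
  interpret pair_graph T using assms by (simp add: undirected_tree_def)
  interpret bridge_tree "pverts T" "parcs T" by (rule bridge_tree_undirected_tree[OF assms])
  let ?M = "{sum w S | S. connected_safe_set (with_proj T) w S}"
  have "?M \<subseteq> sum w ` Pow (pverts T)"
    by (auto simp: connected_safe_set_iff[OF connV])
  then have "finite ?M" using finV finite_subset by blast
  moreover have "connected_safe_set (with_proj T) w (pverts T)"
    using connV by (auto simp: connected_safe_set_iff[OF connV] conn_def)
  ultimately have "Min ?M \<in> ?M" by (intro Min_in) auto
  then show thesis using that by (auto simp: cs_def)
qed

lemma (in bridge_tree) card_edge_list:
  assumes "edge_list T es" "pverts T = V" "parcs T = R"
  shows "length es = card V - 1"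
proof -
  have es: "R = set es \<union> (set es)\<inverse>" "set es \<inter> (set es)\<inverse> = {}" "distinct es"
    using assms by (auto simp: edge_list_def)
  have "card R = card (set es) + card ((set es)\<inverse>)"
    unfolding es(1) using es by (intro card_Un_disjoint) auto
  then have "card R = 2 * length es" using distinct_card[OF es(3)] by simp
  moreover have "R \<inter> V \<times> V = R" using RV by auto
  ultimately show ?thesis using card_arcs[OF connV] by simp
qed

section \<open>Reasoning about the random access machine\<close>

text \<open>A total-correctness triple with an upper bound on the time, so that costs can be added
  without exact counting.\<close>

definition runs :: "com \<Rightarrow> state \<Rightarrow> nat \<Rightarrow> (state \<Rightarrow> bool) \<Rightarrow> bool" where
  "runs c s K Q \<longleftrightarrow> (\<exists>t s'. exec c s t s' \<and> t \<le> K \<and> Q s')"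

lemma runs_mono: "runs c s K P \<Longrightarrow> K \<le> K' \<Longrightarrow> (\<And>s'. P s' \<Longrightarrow> Q s') \<Longrightarrow> runs c s K' Q"
  unfolding runs_def using order_trans by blast

lemma runs_Seq:
  assumes "runs c s K P" "\<And>s'. P s' \<Longrightarrow> runs d s' L Q"
  shows "runs (Seq c d) s (K + L) Q"
  using assms unfolding runs_def by (meson add_mono exec.Seq)

text \<open>\<open>I j\<close> ties the counter register to \<open>j\<close> and the bound register
  to \<open>N\<close>. Each iteration pays \<open>K\<close> and one test; the final 1 is the failing
  test.\<close>

lemma runs_while:
  assumes cnt: "\<And>j s. I j s \<Longrightarrow> fst s i = j \<and> fst s b = N"
    and step: "\<And>j s. j < N \<Longrightarrow> I j s \<Longrightarrow> runs c s K (I (Suc j))"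
    and init: "I 0 s"
  shows "runs (WhileLess i b c) s (N * (K + 1) + 1) (I N)"
proof -
  have "runs (WhileLess i b c) s (k * (K + 1) + 1) (I N)" if "I j s" "j + k = N" for j k s
    using that
  proof (induction k arbitrary: j s)
    case 0
    then have "\<not> fst s i < fst s b" using cnt by fastforce
    then have "exec (WhileLess i b c) s 1 s" by (rule WhileFalse)
    moreover have "I N s" using 0 by simp
    ultimately show ?case unfolding runs_def by (intro exI[of _ 1] exI[of _ s]) simp
  next
    case (Suc k)
    have lt: "fst s i < fst s b" using cnt[OF Suc.prems(1)] Suc.prems(2) by simp
    obtain t s' where t: "exec c s t s'" "t \<le> K" "I (Suc j) s'"
      using step[OF _ Suc.prems(1)] Suc.prems(2) unfolding runs_def by auto
    obtain u s'' where u: "exec (WhileLess i b c) s' u s''" "u \<le> k * (K + 1) + 1" "I N s''"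
      using Suc.IH[OF t(3)] Suc.prems(2) unfolding runs_def by auto
    have "exec (WhileLess i b c) s (1 + t + u) s''" by (rule WhileTrue[OF lt t(1) u(1)])
    moreover have "1 + t + u \<le> Suc k * (K + 1) + 1" using t(2) u(2) by simp
    ultimately show ?case using u(3) unfolding runs_def by blast
  qed
  from this[OF init, of N] show ?thesis by simp
qed

fun straight :: "com \<Rightarrow> bool" where
  "straight (Seq c d) \<longleftrightarrow> straight c \<and> straight d"
| "straight (IfLess x y c d) \<longleftrightarrow> straight c \<and> straight d"
| "straight (WhileLess x y c) \<longleftrightarrow> False"
| "straight _ \<longleftrightarrow> True"

text \<open>Both branches are charged: more than the true cost, but independent of the
  state.\<close>

fun cost :: "com \<Rightarrow> nat" where
  "cost (Seq c d) = cost c + cost d"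
| "cost (IfLess x y c d) = 1 + cost c + cost d"
| "cost _ = 1"

text \<open>An evaluator for programs without loops, so that simplification computes the effect of a
  block. Its value on loops is a dummy, as \<open>straight\<close> excludes them.\<close>

fun result :: "com \<Rightarrow> state \<Rightarrow> state" where
  "result (Const x k) (r, m) = (r(x := k), m)"
| "result (Move x y) (r, m) = (r(x := r y), m)"
| "result (Add x y z) (r, m) = (r(x := r y + r z), m)"
| "result (Sub x y z) (r, m) = (r(x := r y - r z), m)"
| "result (Load x a) (r, m) = (r(x := m (r a)), m)"
| "result (Store a x) (r, m) = (r, m(r a := r x))"
| "result (Seq c d) s = result d (result c s)"
| "result (IfLess x y c d) (r, m) = (if r x < r y then result c (r, m) else result d (r, m))"
| "result _ s = s"

lemma exec_straight: "straight c \<Longrightarrow> \<exists>t. t \<le> cost c \<and> exec c s t (result c s)"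
proof (induction c arbitrary: s)
  case (Seq c d)
  obtain t where t: "t \<le> cost c" "exec c s t (result c s)" using Seq.IH(1)[of s] Seq.prems by (meson straight.simps)
  obtain u where u: "u \<le> cost d" "exec d (result c s) u (result d (result c s))"
    using Seq.IH(2)[of "result c s"] Seq.prems by (meson straight.simps)
  show ?case using t u exec.Seq[OF t(2) u(2)] by (intro exI[of _ "t + u"]) simp
next
  case (IfLess x y c d)
  obtain r m where s: "s = (r, m)" by fastforce
  obtain t where t: "t \<le> cost c" "exec c s t (result c s)" using IfLess.IH(1)[of s] IfLess.prems by (meson straight.simps)
  obtain u where u: "u \<le> cost d" "exec d s u (result d s)" using IfLess.IH(2)[of s] IfLess.prems by (meson straight.simps)
  show ?case
  proof (cases "r x < r y")
    case True
    then have "exec (IfLess x y c d) s (1 + t) (result c s)" using t by (intro IfTrue) (auto simp: s)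
    then show ?thesis using True t by (intro exI[of _ "1 + t"]) (simp add: s)
  next
    case False
    then have "exec (IfLess x y c d) s (1 + u) (result d s)" using u by (intro IfFalse) (auto simp: s)
    then show ?thesis using False u by (intro exI[of _ "1 + u"]) (simp add: s)
  qed
next
  case (Const x k)
  show ?case using exec.Const by (cases s) (metis cost.simps result.simps order_refl)
next
  case (Move x y)
  show ?case using exec.Move by (cases s) (metis cost.simps result.simps order_refl)
next
  case (Add x y z)
  show ?case using exec.Add by (cases s) (metis cost.simps result.simps order_refl)
next
  case (Sub x y z)
  show ?case using exec.Sub by (cases s) (metis cost.simps result.simps order_refl)
next
  case (Load x a)
  show ?case using exec.Load by (cases s) (metis cost.simps result.simps order_refl)
next
  case (Store a x)
  show ?case using exec.Store by (cases s) (metis cost.simps result.simps order_refl)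
next
  case Skip
  show ?case using exec.Skip by (metis cost.simps result.simps order_refl)
next
  case (WhileLess x y c)
  then show ?case by simp
qed

lemma runs_straight: "straight c \<Longrightarrow> Q (result c s) \<Longrightarrow> runs c s (cost c) Q"
  using exec_straight unfolding runs_def by blast

fun block :: "com list \<Rightarrow> com" where
  "block [] = Skip"
| "block [c] = c"
| "block (c # d # ps) = Seq c (block (d # ps))"

section \<open>The program\<close>

text \<open>
  Memory: cells \<open>0..n-1\<close> flag the vertices of the current set \<open>A\<close>, the edge list stays at \<open>n..3n-3\<close>, and the
  arrays at \<open>3n\<close>, \<open>4n\<close>, \<open>5n\<close>, \<open>6n\<close> hold the weights, the branch weights, the degrees in \<open>T[A]\<close>, and some
  neighbour in \<open>T[A]\<close> (for a leaf, the only one).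
  Registers: 1 and 2 hold the constants 1 and 0, 3 the number of edges, 4 to 7 the base addresses of the
  four arrays, 8 the weight of \<open>A\<close>, 9 and 10 the counters of the outer and the inner loops,
  16 and 17 the smallest branch weight of a leaf seen so far and that leaf.
\<close>

definition layout :: "nat \<Rightarrow> (nat \<times> nat) list \<Rightarrow> (nat \<Rightarrow> nat) \<Rightarrow> nat set \<Rightarrow> (nat \<Rightarrow> nat) \<Rightarrow> state \<Rightarrow> bool" where
  "layout n es w A acc s \<longleftrightarrow>
     fst s 0 = n \<and> fst s 1 = 1 \<and> fst s 2 = 0 \<and> fst s 3 = n - 1 \<and>
     fst s 4 = 3 * n \<and> fst s 5 = 4 * n \<and> fst s 6 = 5 * n \<and> fst s 7 = 6 * n \<and> fst s 8 = sum w A \<and>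
     (\<forall>x<n. snd s x = (if x \<in> A then 1 else 0)) \<and>
     (\<forall>j<n - 1. snd s (n + j + j) = fst (es ! j) \<and> snd s (n + j + j + 1) = snd (es ! j)) \<and>
     (\<forall>x<n. snd s (3 * n + x) = w x) \<and> (\<forall>x<n. snd s (4 * n + x) = acc x)"

text \<open>Registers below 10 and cells below \<open>5 * n\<close> hold everything that
  \<open>layout\<close> describes and the outer counter. The rest is scratch space of a single
  round.\<close>

definition keeps :: "nat \<Rightarrow> state \<Rightarrow> state \<Rightarrow> bool" where
  "keeps n s s' \<longleftrightarrow> (\<forall>i<10. fst s' i = fst s i) \<and> (\<forall>a<5 * n. snd s' a = snd s a)"

lemma keeps_trans: "keeps n s s' \<Longrightarrow> keeps n s' s'' \<Longrightarrow> keeps n s s''"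
  by (simp add: keeps_def)

lemma layout_keeps:
  assumes "keeps n s s'" "layout n es w A acc s"
  shows "layout n es w A acc s'"
  using assms unfolding layout_def keeps_def by simp

definition clear_degrees :: com where
  "clear_degrees = block [Const 10 0, WhileLess 10 0 (block [Add 12 6 10, Store 12 2, Add 10 10 1])]"

text \<open>Register 2 is 0, so \<open>IfLess 2 14\<close> tests whether a flag is set. Register 10
  is added twice because edge \<open>j\<close> starts at cell \<open>n + 2 * j\<close> and there is
  no multiplication.\<close>

definition scan_edge :: com where
  "scan_edge = block [Add 11 0 10, Add 11 11 10, Load 12 11, Add 11 11 1, Load 13 11,
     Load 14 12, Load 15 13,
     IfLess 2 14 (IfLess 2 15 (block
       [Add 11 6 12, Load 14 11, Add 14 14 1, Store 11 14,
        Add 11 6 13, Load 14 11, Add 14 14 1, Store 11 14,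
        Add 11 7 12, Store 11 13, Add 11 7 13, Store 11 12]) Skip) Skip,
     Add 10 10 1]"

definition count_degrees :: com where
  "count_degrees = block [Const 10 0, WhileLess 10 3 scan_edge]"

definition scan_leaf :: com where
  "scan_leaf = block [Load 11 10, Add 12 6 10, Load 12 12, Add 13 5 10, Load 13 13, Const 14 2,
     IfLess 2 11 (IfLess 2 12 (IfLess 12 14 (IfLess 13 16
       (block [Move 16 13, Move 17 10]) Skip) Skip) Skip) Skip,
     Add 10 10 1]"

text \<open>
  Starting from $w(A) + 1$ needs no special case for a set without leaves: any value above $w(A)$ makes
  \<open>prune_leaf\<close> do nothing.
\<close>

definition find_leaf :: com where
  "find_leaf = Seq (block [Const 10 0, Add 16 8 1, Const 17 0]) (WhileLess 10 0 scan_leaf)"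

text \<open>The flags start at cell 0, so register 17, which holds the leaf, is itself the address
  of the flag to be cleared.\<close>

definition prune_leaf :: com where
  "prune_leaf = block [Add 11 16 16, IfLess 8 11 Skip (block
     [Add 11 7 17, Load 11 11, Add 12 5 11, Load 13 12, Add 13 13 16, Store 12 13,
      Add 12 4 17, Load 12 12, Sub 8 8 12, Store 17 2])]"

definition prune_round :: com where
  "prune_round = Seq clear_degrees (Seq count_degrees (Seq find_leaf (Seq prune_leaf (Add 9 9 1))))"

definition set_bases :: com where
  "set_bases = block [Const 1 1, Sub 3 0 1, Add 4 0 0, Add 4 4 0, Add 5 4 0, Add 6 5 0, Add 7 6 0]"

text \<open>The first \<open>n\<close> cells hold weights on input and the characteristic vector on
  output, so each weight is copied away before its cell becomes a flag.\<close>

definition copy_weight :: com where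
  "copy_weight = block [Load 11 10, Add 12 4 10, Store 12 11, Add 12 5 10, Store 12 11,
     Store 10 1, Add 8 8 11, Add 10 10 1]"

definition initialize :: com where
  "initialize = Seq set_bases (WhileLess 10 0 copy_weight)"

text \<open>A round that prunes nothing leaves \<open>A\<close> unchanged, so all later rounds are idle and $n$ rounds suffice.\<close>

definition algorithm :: com where
  "algorithm = Seq initialize (WhileLess 9 0 prune_round)"

section \<open>The loops of a pruning round\<close>

lemma runs_clear_degrees:
  assumes L: "layout n es w A acc s"
  shows "runs clear_degrees s (4 * n + 2) (\<lambda>s'. keeps n s s' \<and> (\<forall>x<n. snd s' (5 * n + x) = 0))"
proof -
  define I where "I j s' \<longleftrightarrow> fst s' 10 = j \<and> keeps n s s' \<and> (\<forall>x<j. snd s' (5 * n + x) = 0)" for j s'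
  have regs: "fst s 0 = n" "fst s 1 = 1" "fst s 2 = 0" "fst s 6 = 5 * n"
    using L by (simp_all add: layout_def)
  have step: "runs (block [Add 12 6 10, Store 12 2, Add 10 10 1]) s' 3 (I (Suc j))" if "j < n" "I j s'" for j s'
  proof -
    obtain r m where s': "s' = (r, m)" by fastforce
    have r: "r 10 = j" "\<And>i. i < 10 \<Longrightarrow> r i = fst s i"
      using that(2) by (auto simp: I_def keeps_def s')
    have "I (Suc j) (result (block [Add 12 6 10, Store 12 2, Add 10 10 1]) s')"
      using that r regs by (auto simp: I_def keeps_def s' less_Suc_eq)
    then show ?thesis using runs_straight[of "block [Add 12 6 10, Store 12 2, Add 10 10 1]" "I (Suc j)" s']
      by (simp add: numeral_3_eq_3)
  qed
  have "runs (WhileLess 10 0 (block [Add 12 6 10, Store 12 2, Add 10 10 1])) s' (n * (3 + 1) + 1) (I n)"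
    if "I 0 s'" for s'
    by (rule runs_while[OF _ step that]) (auto simp: I_def keeps_def regs)
  moreover have "runs (Const 10 0) s 1 (I 0)"
    using runs_straight[of "Const 10 0" "I 0" s] by (cases s) (simp add: I_def keeps_def)
  ultimately have "runs clear_degrees s (1 + (n * (3 + 1) + 1)) (I n)"
    unfolding clear_degrees_def block.simps by (rule runs_Seq[rotated])
  then show ?thesis by (rule runs_mono) (auto simp: I_def)
qed

definition scanned_nbrs :: "(nat \<times> nat) list \<Rightarrow> nat set \<Rightarrow> nat \<Rightarrow> nat \<Rightarrow> nat set" where
  "scanned_nbrs es A j x = {y \<in> A. (x, y) \<in> set (take j es) \<or> (y, x) \<in> set (take j es)}"

text \<open>The neighbour array is never cleared: nothing is said about the cell of a vertex without
  scanned neighbours, so remains of earlier rounds do no harm.\<close>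

definition scanned :: "nat \<Rightarrow> (nat \<times> nat) list \<Rightarrow> nat set \<Rightarrow> nat \<Rightarrow> (nat \<Rightarrow> nat) \<Rightarrow> bool" where
  "scanned n es A j m \<longleftrightarrow> (\<forall>x\<in>A. m (5 * n + x) = card (scanned_nbrs es A j x) \<and>
     (scanned_nbrs es A j x \<noteq> {} \<longrightarrow> m (6 * n + x) \<in> scanned_nbrs es A j x))"

lemma result_scan_edge:
  assumes r: "r 0 = n" "r 1 = 1" "r 2 = 0" "r 6 = 5 * n" "r 7 = 6 * n" "r 10 = j"
    and m: "m (n + j + j) = u" "m (n + j + j + 1) = v"
    and alive: "m u = (if u \<in> A then 1 else 0)" "m v = (if v \<in> A then 1 else 0)"
    and uv: "u < n" "v < n" "u \<noteq> v"
  shows "snd (result scan_edge (r, m)) =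
      (if u \<in> A \<and> v \<in> A then m(5 * n + u := m (5 * n + u) + 1, 5 * n + v := m (5 * n + v) + 1,
         6 * n + u := v, 6 * n + v := u) else m)"
    and "i < 10 \<Longrightarrow> fst (result scan_edge (r, m)) i = r i"
    and "fst (result scan_edge (r, m)) 10 = Suc j"
  using assms by (simp_all add: scan_edge_def)

text \<open>Each edge is listed once and in one orientation, so neither \<open>(u, v)\<close> nor
  \<open>(v, u)\<close> was scanned before. Hence each end gains a new neighbour and its degree
  grows by exactly one.\<close>

lemma scanned_Suc:
  assumes S: "scanned n es A j m" and A: "A \<subseteq> {..<n}" and j: "j < length es" and e: "es ! j = (u, v)"
    and es: "distinct es" "set es \<inter> (set es)\<inverse> = {}" and uv: "u < n" "v < n" "u \<noteq> v"
  shows "scanned n es A (Suc j)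
      (if u \<in> A \<and> v \<in> A then m(5 * n + u := m (5 * n + u) + 1, 5 * n + v := m (5 * n + v) + 1,
         6 * n + u := v, 6 * n + v := u) else m)"
proof -
  let ?N = "scanned_nbrs es A"
  have finA: "finite A" using A finite_subset by blast
  have set: "set (take (Suc j) es) = insert (u, v) (set (take j es))"
    using j e by (simp add: take_Suc_conv_app_nth)
  have in_es: "(u, v) \<in> set es" using j e nth_mem by force
  have n1: "(u, v) \<notin> set (take j es)"
    using es(1) j e by (metis distinct_take id_take_nth_drop not_distinct_conv_prefix)
  have n2: "(v, u) \<notin> set (take j es)"
    using in_es es(2) set_take_subset[of j es] by auto
  show ?thesis
  proof (cases "u \<in> A \<and> v \<in> A")
    case False
    then have "?N (Suc j) x = ?N j x" if "x \<in> A" for x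
      using that unfolding scanned_nbrs_def set by auto
    then show ?thesis using S unfolding if_not_P[OF False] scanned_def by simp
  next
    case True
    have Nu: "?N (Suc j) u = insert v (?N j u)" and Nv: "?N (Suc j) v = insert u (?N j v)"
      using True uv unfolding scanned_nbrs_def set by auto
    have Nx: "?N (Suc j) x = ?N j x" if "x \<noteq> u" "x \<noteq> v" for x
      using that unfolding scanned_nbrs_def set by auto
    have fin: "finite (?N j x)" for x using finA by (simp add: scanned_nbrs_def)
    have nu: "v \<notin> ?N j u" "u \<notin> ?N j v" using n1 n2 by (auto simp: scanned_nbrs_def)
    have cu: "card (?N (Suc j) u) = card (?N j u) + 1" "card (?N (Suc j) v) = card (?N j v) + 1"
      unfolding Nu Nv using fin nu by simp_all
    have m: "m (5 * n + x) = card (?N j x)" "?N j x \<noteq> {} \<Longrightarrow> m (6 * n + x) \<in> ?N j x" if "x \<in> A" for x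
      using S that unfolding scanned_def by auto
    let ?m = "m(5 * n + u := m (5 * n + u) + 1, 5 * n + v := m (5 * n + v) + 1,
         6 * n + u := v, 6 * n + v := u)"
    have "?m (5 * n + x) = card (?N (Suc j) x) \<and> (?N (Suc j) x \<noteq> {} \<longrightarrow> ?m (6 * n + x) \<in> ?N (Suc j) x)"
      if x: "x \<in> A" for x
    proof -
      have xn: "x < n" using x A by auto
      consider "x = u" | "x = v" | "x \<noteq> u" "x \<noteq> v" by blast
      then show ?thesis
      proof cases
        case 1
        then show ?thesis using uv cu m[of u] True Nu by simp
      next
        case 2
        then show ?thesis using uv cu m[of v] True Nv by simp
      next
        case 3
        then show ?thesis using uv xn m[OF x] Nx by simp
      qed
    qed
    then show ?thesis unfolding if_P[OF True] scanned_def by blast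
  qed
qed

lemma runs_count_degrees:
  assumes L: "layout n es w A acc s" and A: "A \<subseteq> {..<n}"
    and es: "length es = n - 1" "distinct es" "set es \<inter> (set es)\<inverse> = {}"
    and esn: "set es \<subseteq> {..<n} \<times> {..<n}"
    and z: "\<forall>x<n. snd s (5 * n + x) = 0"
  shows "runs count_degrees s (40 * n + 2) (\<lambda>s'. keeps n s s' \<and> scanned n es A (n - 1) (snd s'))"
proof -
  define I where "I j s' \<longleftrightarrow> fst s' 10 = j \<and> keeps n s s' \<and> scanned n es A j (snd s')" for j s'
  have regs: "fst s 3 = n - 1" using L by (simp add: layout_def)
  have step: "runs scan_edge s' 30 (I (Suc j))" if j: "j < n - 1" and I: "I j s'" for j s'
  proof -
    obtain r m where s': "s' = (r, m)" by fastforce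
    have k: "keeps n s s'" and S: "scanned n es A j m" and r10: "r 10 = j"
      using I by (auto simp: I_def s')
    have L': "layout n es w A acc (r, m)" using layout_keeps[OF k L] by (simp add: s')
    obtain u v where e: "es ! j = (u, v)" by fastforce
    have "(u, v) \<in> set es" using e j es(1) nth_mem by metis
    then have uv: "u < n" "v < n" "u \<noteq> v" using esn es(3) by auto
    have r: "r 0 = n" "r 1 = 1" "r 2 = 0" "r 6 = 5 * n" "r 7 = 6 * n"
      and m: "m (n + j + j) = u" "m (n + j + j + 1) = v"
      and alive: "m u = (if u \<in> A then 1 else 0)" "m v = (if v \<in> A then 1 else 0)"
      using L' e uv j unfolding layout_def by simp_all
    note res = result_scan_edge[where r = r and m = m, OF r r10 m alive uv]
    have "scanned n es A (Suc j) (snd (result scan_edge s'))"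
      unfolding s' res(1) using scanned_Suc[OF S A _ e es(2,3) uv] j es(1) by simp
    moreover have "keeps n s (result scan_edge s')"
      using k uv res(1,2) unfolding keeps_def s' by simp
    ultimately have "I (Suc j) (result scan_edge s')" using res(3) by (simp add: I_def s')
    moreover have "straight scan_edge" "cost scan_edge \<le> 30" by (simp_all add: scan_edge_def)
    ultimately show ?thesis using runs_straight runs_mono by blast
  qed
  have "runs (WhileLess 10 3 scan_edge) s' ((n - 1) * (30 + 1) + 1) (I (n - 1))" if "I 0 s'" for s'
    by (rule runs_while[OF _ step that]) (auto simp: I_def keeps_def regs)
  moreover have "scanned n es A 0 (snd s)" using z A by (auto simp: scanned_def scanned_nbrs_def)
  then have "runs (Const 10 0) s 1 (I 0)"
    using runs_straight[of "Const 10 0" "I 0" s] by (cases s) (simp add: I_def keeps_def)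
  ultimately have "runs count_degrees s (1 + ((n - 1) * (30 + 1) + 1)) (I (n - 1))"
    unfolding count_degrees_def block.simps by (rule runs_Seq[rotated])
  then show ?thesis by (rule runs_mono) (auto simp: I_def)
qed

text \<open>The value \<open>tot + 1\<close> means that no leaf is recorded, and then
  \<open>v\<close> is meaningless. The lower bound still holds, so every leaf seen has branch weight
  above \<open>tot\<close>.\<close>

definition best_leaf :: "(nat \<times> nat) set \<Rightarrow> nat set \<Rightarrow> (nat \<Rightarrow> nat) \<Rightarrow> nat \<Rightarrow> nat \<Rightarrow> nat \<Rightarrow> nat \<Rightarrow> bool" where
  "best_leaf R A acc tot j b v \<longleftrightarrow> (\<forall>l<j. leaf R A l \<longrightarrow> b \<le> acc l) \<and>
     (b = tot + 1 \<or> leaf R A v \<and> b = acc v)"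

lemma result_scan_leaf:
  assumes r: "r 2 = 0" "r 5 = 4 * n" "r 6 = 5 * n" "r 10 = j"
    and m: "m j = (if j \<in> A then 1 else 0)" "j \<in> A \<Longrightarrow> m (5 * n + j) = card (nbrs R A j)" "m (4 * n + j) = acc j"
    and best: "best_leaf R A acc tot j (r 16) (r 17)"
    and r1: "r 1 = 1"
  shows "snd (result scan_leaf (r, m)) = m"
    and "i < 10 \<Longrightarrow> fst (result scan_leaf (r, m)) i = r i"
    and "fst (result scan_leaf (r, m)) 10 = Suc j"
    and "best_leaf R A acc tot (Suc j) (fst (result scan_leaf (r, m)) 16) (fst (result scan_leaf (r, m)) 17)"
proof -
  \<comment> \<open>The machine only compares with \<open><\<close>, so degree 1 is tested as lying
    strictly between 0 and 2.\<close>
  have lf: "leaf R A j \<longleftrightarrow> j \<in> A \<and> 0 < m (5 * n + j) \<and> m (5 * n + j) < 2"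
    using m(2) by (auto simp: leaf_def)
  have up: "best_leaf R A acc tot (Suc j) (r 16) (r 17)" if "leaf R A j \<Longrightarrow> r 16 \<le> acc j"
    using best that unfolding best_leaf_def by (auto simp: less_Suc_eq)
  have new: "best_leaf R A acc tot (Suc j) (acc j) j" if j: "leaf R A j" "acc j < r 16"
  proof -
    have "acc j \<le> acc l" if l: "l < Suc j" "leaf R A l" for l
    proof (cases "l = j")
      case False
      then have "r 16 \<le> acc l" using l best by (simp add: best_leaf_def)
      then show ?thesis using j by linarith
    qed simp
    then show ?thesis using j by (simp add: best_leaf_def)
  qed
  show "snd (result scan_leaf (r, m)) = m"
    and "i < 10 \<Longrightarrow> fst (result scan_leaf (r, m)) i = r i"
    and "fst (result scan_leaf (r, m)) 10 = Suc j"
    using r r1 by (simp_all add: scan_leaf_def)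
  show "best_leaf R A acc tot (Suc j) (fst (result scan_leaf (r, m)) 16) (fst (result scan_leaf (r, m)) 17)"
    using r m(1,3) up new lf by (auto simp: scan_leaf_def)
qed

lemma runs_find_leaf:
  assumes L: "layout n es w A acc s"
    and deg: "\<And>x. x \<in> A \<Longrightarrow> snd s (5 * n + x) = card (nbrs R A x)"
  shows "runs find_leaf s (40 * n + 4) (\<lambda>s'. keeps n s s' \<and> snd s' = snd s \<and>
     best_leaf R A acc (sum w A) n (fst s' 16) (fst s' 17))"
proof -
  define I where "I j s' \<longleftrightarrow> fst s' 10 = j \<and> keeps n s s' \<and> snd s' = snd s \<and>
    best_leaf R A acc (sum w A) j (fst s' 16) (fst s' 17)" for j s'
  have regs: "fst s 0 = n" "fst s 1 = 1" "fst s 8 = sum w A" using L by (simp_all add: layout_def)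
  have step: "runs scan_leaf s' 30 (I (Suc j))" if j: "j < n" and I: "I j s'" for j s'
  proof -
    obtain r m where s': "s' = (r, m)" by fastforce
    have k: "keeps n s s'" and ms: "m = snd s" and r10: "r 10 = j"
      and best: "best_leaf R A acc (sum w A) j (r 16) (r 17)"
      using I by (auto simp: I_def s')
    have L': "layout n es w A acc (r, m)" using layout_keeps[OF k L] by (simp add: s')
    have r: "r 2 = 0" "r 5 = 4 * n" "r 6 = 5 * n" and r1: "r 1 = 1"
      and m: "m j = (if j \<in> A then 1 else 0)" "m (4 * n + j) = acc j"
      using L' j unfolding layout_def by simp_all
    have d: "j \<in> A \<Longrightarrow> m (5 * n + j) = card (nbrs R A j)" using deg ms by simp
    note res = result_scan_leaf[where r = r and m = m, OF r r10 m(1) d m(2) best r1]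
    have "keeps n s (result scan_leaf s')"
      using k res(1,2) unfolding keeps_def s' by simp
    then have "I (Suc j) (result scan_leaf s')" using res ms by (simp add: I_def s')
    moreover have "straight scan_leaf" "cost scan_leaf \<le> 30" by (simp_all add: scan_leaf_def)
    ultimately show ?thesis using runs_straight runs_mono by blast
  qed
  have loop: "runs (WhileLess 10 0 scan_leaf) s' (n * (30 + 1) + 1) (I n)" if "I 0 s'" for s'
    by (rule runs_while[OF _ step that]) (auto simp: I_def keeps_def regs)
  let ?c = "block [Const 10 0, Add 16 8 1, Const 17 0]"
  have "I 0 (result ?c s)"
    using regs by (cases s) (simp add: I_def keeps_def best_leaf_def)
  then have "runs ?c s 3 (I 0)" using runs_straight[of ?c "I 0" s] by (simp add: numeral_3_eq_3)
  then have "runs find_leaf s (3 + (n * (30 + 1) + 1)) (I n)"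
    unfolding find_leaf_def using loop by (rule runs_Seq)
  then show ?thesis by (rule runs_mono) (auto simp: I_def)
qed

section \<open>The pruning step on the machine and the invariant of the rounds\<close>

lemma result_prune_leaf_stop:
  assumes "layout n es w A acc (r, m)" "sum w A < r 16 + r 16"
  shows "keeps n (r, m) (result prune_leaf (r, m))"
  using assms by (simp add: prune_leaf_def layout_def keeps_def)

lemma result_prune_leaf:
  assumes L: "layout n es w A acc (r, m)" and go: "r 16 + r 16 \<le> sum w A" and b: "r 16 = acc v"
    and v: "r 17 = v" "v \<in> A" "v < n" and p: "m (6 * n + v) = p" "p < n" and A: "finite A"
  shows "layout n es w (A - {v}) (acc(p := acc p + acc v)) (result prune_leaf (r, m))"
    and "fst (result prune_leaf (r, m)) 9 = r 9"
proof -
  have r: "r 0 = n" "r 1 = 1" "r 2 = 0" "r 3 = n - 1" "r 4 = 3 * n" "r 5 = 4 * n" "r 6 = 5 * n" "r 7 = 6 * n"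
      "r 8 = sum w A"
    and alive: "\<And>x. x < n \<Longrightarrow> m x = (if x \<in> A then 1 else 0)"
    and ed: "\<And>j. j < n - 1 \<Longrightarrow> m (n + j + j) = fst (es ! j) \<and> m (n + j + j + 1) = snd (es ! j)"
    and ws: "\<And>x. x < n \<Longrightarrow> m (3 * n + x) = w x" and ac: "\<And>x. x < n \<Longrightarrow> m (4 * n + x) = acc x"
    using L unfolding layout_def fst_conv snd_conv by blast+
  \<comment> \<open>The truncated subtraction of the machine is exact here because \<open>v\<close>
    lies in \<open>A\<close>.\<close>
  have tot: "sum w A - w v = sum w (A - {v})" using sum.remove[OF A v(2), of w] by simp
  have res: "snd (result prune_leaf (r, m)) = m(4 * n + p := acc p + acc v, v := 0)"
    "fst (result prune_leaf (r, m)) 8 = sum w (A - {v})"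
    "\<And>i. i < 10 \<Longrightarrow> i \<noteq> 8 \<Longrightarrow> fst (result prune_leaf (r, m)) i = r i"
    using go r v p b ac[of p] ws[of v] tot by (simp_all add: prune_leaf_def)
  show "fst (result prune_leaf (r, m)) 9 = r 9" using res(3) by simp
  have "(m(4 * n + p := acc p + acc v, v := 0)) x = (if x \<in> A - {v} then 1 else 0)" if "x < n" for x
    using that alive[OF that] by simp
  moreover have "(m(4 * n + p := acc p + acc v, v := 0)) (n + j + j) = fst (es ! j) \<and>
    (m(4 * n + p := acc p + acc v, v := 0)) (n + j + j + 1) = snd (es ! j)" if j: "j < n - 1" for j
  proof -
    have "n + j + j \<noteq> 4 * n + p" "n + j + j \<noteq> v" "n + j + j + 1 \<noteq> 4 * n + p" "n + j + j + 1 \<noteq> v"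
      using j v by linarith+
    then show ?thesis using ed[OF j] unfolding fun_upd_apply by presburger
  qed
  moreover have "(m(4 * n + p := acc p + acc v, v := 0)) (3 * n + x) = w x" if "x < n" for x
    using that v ws[OF that] by simp
  moreover have "(m(4 * n + p := acc p + acc v, v := 0)) (4 * n + x) = (acc(p := acc p + acc v)) x" if "x < n" for x
    using that v ac[OF that] by simp
  ultimately show "layout n es w (A - {v}) (acc(p := acc p + acc v)) (result prune_leaf (r, m))"
    unfolding layout_def res(1) using res(2,3) r by simp
qed

lemma cost_prune_leaf: "straight prune_leaf" "cost prune_leaf \<le> 20"
  by (simp_all add: prune_leaf_def)

text \<open>The second alternative does not mention \<open>k\<close>, so once no leaf passes the
  test it carries over to all later rounds.\<close>

definition (in bridge_tree) progress :: "('a \<Rightarrow> nat) \<Rightarrow> nat \<Rightarrow> 'a set \<Rightarrow> ('a \<Rightarrow> nat) \<Rightarrow> ('a \<Rightarrow> 'a) \<Rightarrow> bool" where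
  "progress w k A acc rep \<longleftrightarrow> pruned w A acc rep \<and>
     (card A + k \<le> card V \<or> (\<forall>l. leaf R A l \<longrightarrow> sum w A < 2 * acc l))"

locale tree_input = bridge_tree "{0..<n}" R for n :: nat and R :: "(nat \<times> nat) set" +
  fixes es :: "(nat \<times> nat) list" and w :: "nat \<Rightarrow> nat"
  assumes es: "R = set es \<union> (set es)\<inverse>" "set es \<inter> (set es)\<inverse> = {}" "distinct es"
    and len: "length es = n - 1"
begin

definition round_inv :: "nat \<Rightarrow> state \<Rightarrow> bool" where
  "round_inv k s \<longleftrightarrow> fst s 9 = k \<and>
     (\<exists>A acc rep. layout n es w A acc s \<and> progress w k A acc rep)"

lemma scanned_nbrs_all: "scanned_nbrs es A (n - 1) x = nbrs R A x"
  using es(1) len by (auto simp: scanned_nbrs_def nbrs_def)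

lemma prune_leaf_progress:
  assumes L: "layout n es w A acc s" and P: "progress w k A acc rep"
    and S: "scanned n es A (n - 1) (snd s)"
    and B: "best_leaf R A acc (sum w A) n (fst s 16) (fst s 17)"
  shows "\<exists>A acc rep. layout n es w A acc (result prune_leaf s) \<and> progress w (Suc k) A acc rep"
    and "fst (result prune_leaf s) 9 = fst s 9"
proof -
  obtain r m where s: "s = (r, m)" by fastforce
  have pr: "pruned w A acc rep" using P by (simp add: progress_def)
  have A: "A \<subseteq> {0..<n}" "finite A" using prunedD(1)[OF pr] finite_subset by auto
  have bound: "r 16 \<le> acc l" if "leaf R A l" for l
    using B that A by (auto simp: best_leaf_def leaf_def s)
  have *: "(\<exists>A acc rep. layout n es w A acc (result prune_leaf s) \<and> progress w (Suc k) A acc rep) \<and>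
    fst (result prune_leaf s) 9 = fst s 9"
  proof (cases "sum w A < r 16 + r 16")
    case True
    have k: "keeps n s (result prune_leaf s)"
      using result_prune_leaf_stop[OF L[unfolded s] True] by (simp add: s)
    \<comment> \<open>Register 16 is a lower bound for all leaf branches, even if no leaf was
      recorded, so one failed test settles all leaves.\<close>
    have "sum w A < 2 * acc l" if "leaf R A l" for l using bound[OF that] True by linarith
    then have "progress w (Suc k) A acc rep" using pr by (simp add: progress_def)
    then show ?thesis using layout_keeps[OF k L] k by (auto simp: keeps_def)
  next
    case False
    \<comment> \<open>The test rules out the initial value \<open>sum w A + 1\<close>, so register
      17 holds a genuine leaf.\<close>
    then have v: "leaf R A (r 17)" "r 16 = acc (r 17)" using B by (auto simp: best_leaf_def s)
    obtain p where p: "nbrs R A (r 17) = {p}" using nbrs_leaf[OF v(1)] by blast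
    have vA: "r 17 \<in> A" "r 17 < n" using v A by (auto simp: leaf_def)
    have pA: "p \<in> A" "p < n" using p A by (auto simp: nbrs_def)
    have mp: "m (6 * n + r 17) = p"
      using S vA(1) p unfolding scanned_def scanned_nbrs_all s by auto
    have go: "r 16 + r 16 \<le> sum w A" using False by simp
    have pr': "pruned w (A - {r 17}) (acc(p := acc p + acc (r 17))) (\<lambda>x. if rep x = r 17 then p else rep x)"
      by (rule pruned_step[OF pr v(1) p]) (use bound v(2) go in auto)
    \<comment> \<open>The leaf found passes the test, which refutes the second alternative of
      \<open>progress\<close>.\<close>
    have "card A + k \<le> n"
      using P v go unfolding progress_def by fastforce
    then have "card (A - {r 17}) + Suc k \<le> n"
      using vA(1) A(2) by (metis add_Suc_right add_Suc card_Suc_Diff1)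
    then have "progress w (Suc k) (A - {r 17}) (acc(p := acc p + acc (r 17))) (\<lambda>x. if rep x = r 17 then p else rep x)"
      using pr' by (simp add: progress_def)
    then show ?thesis
      using result_prune_leaf[OF L[unfolded s] go v(2) refl vA mp pA(2) A(2)] unfolding s fst_conv by blast
  qed
  show "\<exists>A acc rep. layout n es w A acc (result prune_leaf s) \<and> progress w (Suc k) A acc rep"
    using * by blast
  show "fst (result prune_leaf s) 9 = fst s 9" using * by blast
qed

lemma runs_prune_round:
  assumes "round_inv k s"
  shows "runs prune_round s (84 * n + 29) (round_inv (Suc k))"
proof -
  obtain A acc rep where L: "layout n es w A acc s" and P: "progress w k A acc rep" and k: "fst s 9 = k"
    using assms by (auto simp: round_inv_def)
  have A: "A \<subseteq> {..<n}" using prunedD(1) P by (fastforce simp: progress_def)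
  have esn: "set es \<subseteq> {..<n} \<times> {..<n}" using RV es(1) by auto
  have inc: "runs (Add 9 9 1) s' 1 (round_inv (Suc k))"
    if e: "\<exists>A acc rep. layout n es w A acc s' \<and> progress w (Suc k) A acc rep" and k': "fst s' 9 = k" for s'
  proof -
    obtain A acc rep where L': "layout n es w A acc s'" and P': "progress w (Suc k) A acc rep"
      using e by blast
    have "layout n es w A acc (result (Add 9 9 1) s')" using L' by (cases s') (simp add: layout_def)
    moreover have "fst (result (Add 9 9 1) s') 9 = Suc k" using k' L' by (cases s') (simp add: layout_def)
    ultimately have "round_inv (Suc k) (result (Add 9 9 1) s')" using P' unfolding round_inv_def by blast
    then show ?thesis using runs_straight[of "Add 9 9 1" "round_inv (Suc k)" s'] by simp
  qed
  have prune: "runs prune_leaf s' 20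
      (\<lambda>s''. (\<exists>A acc rep. layout n es w A acc s'' \<and> progress w (Suc k) A acc rep) \<and> fst s'' 9 = k)"
    if "layout n es w A acc s'" "fst s' 9 = k" "scanned n es A (n - 1) (snd s')"
      "best_leaf R A acc (sum w A) n (fst s' 16) (fst s' 17)" for s'
  proof -
    have "runs prune_leaf s' (cost prune_leaf)
      (\<lambda>s''. (\<exists>A acc rep. layout n es w A acc s'' \<and> progress w (Suc k) A acc rep) \<and> fst s'' 9 = k)"
      by (rule runs_straight[OF cost_prune_leaf(1)])
        (use prune_leaf_progress[OF that(1) P that(3,4)] that(2) in simp)
    then show ?thesis by (rule runs_mono) (use cost_prune_leaf(2) in auto)
  qed
  define Q1 where "Q1 s' \<longleftrightarrow> keeps n s s' \<and> (\<forall>x<n. snd s' (5 * n + x) = 0)" for s'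
  define Q2 where "Q2 s' \<longleftrightarrow> keeps n s s' \<and> scanned n es A (n - 1) (snd s')" for s'
  define Q3 where "Q3 s' \<longleftrightarrow> keeps n s s' \<and> scanned n es A (n - 1) (snd s') \<and>
    best_leaf R A acc (sum w A) n (fst s' 16) (fst s' 17)" for s'
  have 1: "runs clear_degrees s (4 * n + 2) Q1"
    unfolding Q1_def by (rule runs_clear_degrees[OF L])
  have 2: "runs count_degrees s' (40 * n + 2) Q2" if "Q1 s'" for s'
  proof -
    have ks: "keeps n s s'" and z: "\<forall>x<n. snd s' (5 * n + x) = 0" using that by (auto simp: Q1_def)
    show ?thesis
      by (rule runs_mono[OF runs_count_degrees[OF layout_keeps[OF ks L] A len es(3,2) esn z]])
        (auto simp: Q2_def intro: keeps_trans[OF ks])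
  qed
  have 3: "runs find_leaf s' (40 * n + 4) Q3" if "Q2 s'" for s'
  proof -
    have ks: "keeps n s s'" and sc: "scanned n es A (n - 1) (snd s')" using that by (auto simp: Q2_def)
    have deg: "snd s' (5 * n + x) = card (nbrs R A x)" if "x \<in> A" for x
      using sc that unfolding scanned_def scanned_nbrs_all by blast
    show ?thesis
      by (rule runs_mono[OF runs_find_leaf[OF layout_keeps[OF ks L] deg]])
        (use sc in \<open>auto simp: Q3_def intro: keeps_trans[OF ks]\<close>)
  qed
  have 4: "runs (Seq prune_leaf (Add 9 9 1)) s' (20 + 1) (round_inv (Suc k))" if "Q3 s'" for s'
  proof -
    have ks: "keeps n s s'" using that by (simp add: Q3_def)
    have "fst s' 9 = k" using ks k by (simp add: keeps_def)
    then show ?thesis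
      by (intro runs_Seq[OF prune[OF layout_keeps[OF ks L]]]) (use that inc in \<open>auto simp: Q3_def\<close>)
  qed
  have "runs prune_round s (4 * n + 2 + (40 * n + 2 + (40 * n + 4 + (20 + 1)))) (round_inv (Suc k))"
    unfolding prune_round_def
    by (rule runs_Seq[OF 1], rule runs_Seq[OF 2], assumption, rule runs_Seq[OF 3], assumption, rule 4)
  then show ?thesis by (rule runs_mono) auto
qed

end

section \<open>The initial memory and the set-up of the arrays\<close>

lemma length_concat_pairs: "length (concat (map (\<lambda>(u, v). [u, v]) es)) = 2 * length es"
  by (induction es) auto

lemma nth_concat_pairs:
  "j < length es \<Longrightarrow> concat (map (\<lambda>(u, v). [u, v]) es) ! (j + j) = fst (es ! j) \<and>
     concat (map (\<lambda>(u, v). [u, v]) es) ! (j + j + 1) = snd (es ! j)"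
proof (induction es arbitrary: j)
  case (Cons e es)
  then show ?case by (cases j) (auto split: prod.splits)
qed simp

lemma initial_memory:
  shows "x < n \<Longrightarrow> snd (initial_state n w es) x = w x"
    and "j < length es \<Longrightarrow> snd (initial_state n w es) (n + j + j) = fst (es ! j) \<and>
      snd (initial_state n w es) (n + j + j + 1) = snd (es ! j)"
proof -
  have len: "length (input_cells n w es) = n + 2 * length es"
    by (simp add: input_cells_def length_concat_pairs)
  show "snd (initial_state n w es) x = w x" if "x < n"
    using that unfolding initial_state_def len by (simp add: input_cells_def nth_append)
  show "snd (initial_state n w es) (n + j + j) = fst (es ! j) \<and>
      snd (initial_state n w es) (n + j + j + 1) = snd (es ! j)" if j: "j < length es"
  proof -
    have "input_cells n w es ! (n + k) = concat (map (\<lambda>(u, v). [u, v]) es) ! k" for k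
      by (simp add: input_cells_def nth_append)
    from this[of "j + j"] this[of "j + j + 1"] show ?thesis
      using j nth_concat_pairs[OF j] unfolding initial_state_def len by (simp add: add.assoc)
  qed
qed

definition copied :: "nat \<Rightarrow> (nat \<times> nat) list \<Rightarrow> (nat \<Rightarrow> nat) \<Rightarrow> nat \<Rightarrow> state \<Rightarrow> bool" where
  "copied n es w j s \<longleftrightarrow> fst s 10 = j \<and> fst s 9 = 0 \<and>
     fst s 0 = n \<and> fst s 1 = 1 \<and> fst s 2 = 0 \<and> fst s 3 = n - 1 \<and>
     fst s 4 = 3 * n \<and> fst s 5 = 4 * n \<and> fst s 6 = 5 * n \<and> fst s 7 = 6 * n \<and> fst s 8 = sum w {0..<j} \<and>
     (\<forall>x<n. snd s x = (if x < j then 1 else w x)) \<and>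
     (\<forall>i<n - 1. snd s (n + i + i) = fst (es ! i) \<and> snd s (n + i + i + 1) = snd (es ! i)) \<and>
     (\<forall>x<j. snd s (3 * n + x) = w x) \<and> (\<forall>x<j. snd s (4 * n + x) = w x)"

lemma copied_step:
  assumes C: "copied n es w j (r, m)" and j: "j < n"
  shows "copied n es w (Suc j) (result copy_weight (r, m))"
proof -
  have r: "r 10 = j" "r 9 = 0" "r 0 = n" "r 1 = 1" "r 2 = 0" "r 3 = n - 1" "r 4 = 3 * n" "r 5 = 4 * n"
      "r 6 = 5 * n" "r 7 = 6 * n" "r 8 = sum w {0..<j}"
    and al: "\<And>x. x < n \<Longrightarrow> m x = (if x < j then 1 else w x)"
    and ed: "\<And>i. i < n - 1 \<Longrightarrow> m (n + i + i) = fst (es ! i) \<and> m (n + i + i + 1) = snd (es ! i)"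
    and w3: "\<And>x. x < j \<Longrightarrow> m (3 * n + x) = w x" and w4: "\<And>x. x < j \<Longrightarrow> m (4 * n + x) = w x"
    using C unfolding copied_def fst_conv snd_conv by blast+
  let ?m = "m(3 * n + j := w j, 4 * n + j := w j, j := 1)"
  have res: "snd (result copy_weight (r, m)) = ?m"
    "fst (result copy_weight (r, m)) 10 = Suc j" "fst (result copy_weight (r, m)) 8 = sum w {0..<Suc j}"
    "\<And>i. i < 10 \<Longrightarrow> i \<noteq> 8 \<Longrightarrow> fst (result copy_weight (r, m)) i = r i"
    using r al[OF j] by (simp_all add: copy_weight_def)
  have "?m x = (if x < Suc j then 1 else w x)" if "x < n" for x
    using that j al[OF that] by auto
  moreover have "?m (n + i + i) = fst (es ! i) \<and> ?m (n + i + i + 1) = snd (es ! i)" if i: "i < n - 1" for i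
  proof -
    have "n + i + i \<noteq> 3 * n + j" "n + i + i \<noteq> 4 * n + j" "n + i + i \<noteq> j"
      "n + i + i + 1 \<noteq> 3 * n + j" "n + i + i + 1 \<noteq> 4 * n + j" "n + i + i + 1 \<noteq> j"
      using i j by linarith+
    then show ?thesis using ed[OF i] unfolding fun_upd_apply by presburger
  qed
  moreover have "?m (3 * n + x) = w x" if "x < Suc j" for x
    using that j w3[of x] by (auto simp: less_Suc_eq)
  moreover have "?m (4 * n + x) = w x" if "x < Suc j" for x
    using that j w4[of x] by (auto simp: less_Suc_eq)
  ultimately show ?thesis unfolding copied_def res(1) using res(2,3,4) r by simp
qed

lemma runs_initialize:
  assumes len: "length es = n - 1"
  shows "runs initialize (initial_state n w es) (9 * n + 8)
    (\<lambda>s. fst s 9 = 0 \<and> layout n es w {0..<n} w s)"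
proof -
  have step: "runs copy_weight s 8 (copied n es w (Suc j))" if "j < n" "copied n es w j s" for j s
  proof -
    have "copied n es w (Suc j) (result copy_weight s)" using copied_step that by (cases s) simp
    moreover have "straight copy_weight" "cost copy_weight \<le> 8" by (simp_all add: copy_weight_def)
    ultimately show ?thesis using runs_straight runs_mono by blast
  qed
  have loop: "runs (WhileLess 10 0 copy_weight) s (n * (8 + 1) + 1) (copied n es w n)"
    if "copied n es w 0 s" for s
    by (rule runs_while[OF _ step that]) (auto simp: copied_def)
  obtain m where m: "initial_state n w es = ((\<lambda>_. 0)(0 := n), m)" by (simp add: initial_state_def)
  have im: "\<And>x. x < n \<Longrightarrow> m x = w x"
    "\<And>j. j < n - 1 \<Longrightarrow> m (n + j + j) = fst (es ! j) \<and> m (n + j + j + 1) = snd (es ! j)"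
    using initial_memory[where es = es and n = n and w = w] len by (simp_all add: m)
  have "copied n es w 0 (result set_bases (initial_state n w es))"
    using im unfolding m by (simp add: copied_def set_bases_def)
  moreover have "straight set_bases" "cost set_bases \<le> 7" by (simp_all add: set_bases_def)
  ultimately have "runs set_bases (initial_state n w es) 7 (copied n es w 0)"
    using runs_straight runs_mono by blast
  then have "runs initialize (initial_state n w es) (7 + (n * (8 + 1) + 1)) (copied n es w n)"
    unfolding initialize_def using loop by (rule runs_Seq)
  then show ?thesis by (rule runs_mono) (auto simp: copied_def layout_def)
qed

lemma (in tree_input) runs_algorithm:
  "runs algorithm (initial_state n w es) (9 * n + 8 + (n * (84 * n + 30) + 1)) (round_inv n)"
proof -
  have loop: "runs (WhileLess 9 0 prune_round) s (n * (84 * n + 29 + 1) + 1) (round_inv n)"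
    if "fst s 9 = 0 \<and> layout n es w {0..<n} w s" for s
  proof (rule runs_while[where I = round_inv])
    have "progress w 0 {0..<n} w (\<lambda>x. x)" using pruned_initial[of w] by (simp add: progress_def)
    then show "round_inv 0 s" using that unfolding round_inv_def by blast
    show "runs prune_round s (84 * n + 29) (round_inv (Suc k))" if "round_inv k s" for k s
      by (rule runs_prune_round[OF that])
    show "fst s 9 = k \<and> fst s 0 = n" if "round_inv k s" for k s
      using that by (auto simp: round_inv_def layout_def)
  qed
  have "runs algorithm (initial_state n w es) (9 * n + 8 + (n * (84 * n + 29 + 1) + 1)) (round_inv n)"
    unfolding algorithm_def by (rule runs_Seq[OF runs_initialize[OF len] loop])
  then show ?thesis by (rule runs_mono) simp_all
qed

theorem theorem5:
  shows "\<exists>(alg :: com) (time :: nat \<Rightarrow> nat).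
    (\<lambda>n. real (time n)) \<in> O(\<lambda>n. real n ^ 2) \<and>
    (\<forall>(n :: nat) (T :: nat pair_pre_digraph) (es :: (nat \<times> nat) list) (w :: nat \<Rightarrow> nat).
       undirected_tree T \<and> pverts T = {0..<n} \<and> edge_list T es \<longrightarrow>
       (\<exists>t s S. exec alg (initial_state n w es) t s \<and> t \<le> time n \<and> output_set n s S \<and>
          connected_safe_set (with_proj T) w S \<and> sum w S \<le> 2 * cs (with_proj T) w))"
proof (rule exI[of _ algorithm], rule exI[of _ "\<lambda>n. 9 * n + 8 + (n * (84 * n + 30) + 1)"],
    intro conjI allI impI)
  let ?time = "\<lambda>n :: nat. 9 * n + 8 + (n * (84 * n + 30) + 1)"
  \<comment> \<open>132 = 84 + 39 + 9: for \<open>n \<ge> 1\<close> the lower terms of the exact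
    polynomial are bounded by multiples of its leading power.\<close>
  have time: "?time n \<le> 132 * n ^ 2" if "n \<ge> 1" for n :: nat
  proof -
    have "n \<le> n ^ 2" "1 \<le> n ^ 2" using that by (simp_all add: power2_eq_square)
    moreover have "?time n = 84 * n ^ 2 + 39 * n + 9" by (simp add: algebra_simps power2_eq_square)
    ultimately show ?thesis by linarith
  qed
  have "norm (real (?time n)) \<le> 132 * norm (real n ^ 2)" if "n \<ge> 1" for n
  proof -
    have "real (?time n) \<le> real (132 * n ^ 2)" using time[OF that] by (rule of_nat_mono)
    also have "\<dots> = 132 * real n ^ 2" by (simp only: of_nat_mult of_nat_power of_nat_numeral)
    finally show ?thesis by (simp only: norm_of_nat norm_power)
  qed
  then have "eventually (\<lambda>n. norm (real (?time n)) \<le> 132 * norm (real n ^ 2)) sequentially"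
    unfolding eventually_sequentially by blast
  then show "(\<lambda>n. real (?time n)) \<in> O(\<lambda>n. real n ^ 2)" by (rule bigoI)
  fix n :: nat and T :: "nat pair_pre_digraph" and es w
  assume asm: "undirected_tree T \<and> pverts T = {0..<n} \<and> edge_list T es"
  then have T: "undirected_tree T" and V: "pverts T = {0..<n}" and es: "edge_list T es" by auto
  interpret G: pair_graph T using T by (simp add: undirected_tree_def)
  interpret bridge_tree "{0..<n}" "parcs T"
    using bridge_tree_undirected_tree[OF T] by (simp add: V)
  interpret tree_input n "parcs T" es w
    using es card_edge_list[OF es V refl] by unfold_locales (auto simp: edge_list_def)
  obtain t s where run: "exec algorithm (initial_state n w es) t s" "t \<le> ?time n" and fin: "round_inv n s"
    using runs_algorithm unfolding runs_def by blast
  obtain A acc rep where L: "layout n es w A acc s" and P: "progress w n A acc rep"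
    using fin unfolding round_inv_def by blast
  have pr: "pruned w A acc rep" using P by (simp add: progress_def)
  note A = prunedD(1,2)[OF pr]
  \<comment> \<open>Since \<open>A\<close> is not empty, the counting alternative of
    \<open>progress\<close> fails after \<open>n\<close> rounds, and the stopping condition
    remains.\<close>
  have "card A > 0" using A finite_subset[OF A(1)] by (simp add: card_gt_0_iff conn_def)
  then have stop: "\<And>l. leaf (parcs T) A l \<Longrightarrow> sum w A < 2 * acc l"
    using P by (simp add: progress_def)
  note css = G.connected_safe_set_iff[unfolded V, OF connV]
  have safe: "connected_safe_set (with_proj T) w A"
    unfolding css using A prunedD(8)[OF pr] by blast
  obtain S where S: "connected_safe_set (with_proj T) w S" "cs (with_proj T) w = sum w S"
    using cs_attained[OF T] by blast
  have "sum w A \<le> 2 * sum w S"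
    by (rule pruned_two_approx[OF pr stop]) (use S(1)[unfolded css] in auto)
  moreover have "output_set n s A" using L A by (simp add: output_set_def layout_def)
  ultimately show "\<exists>t s S. exec algorithm (initial_state n w es) t s \<and> t \<le> ?time n \<and> output_set n s S \<and>
      connected_safe_set (with_proj T) w S \<and> sum w S \<le> 2 * cs (with_proj T) w"
    using run safe unfolding S(2) by blast
qed

end
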